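(* Let $N\ge2$ and let $\rho\in L^1(\mathbb{R}^N)\cap L^\infty(\mathbb{R}^N)$ with $\rho\ge0$ and $\rho\not\equiv0$. Then for every $k\in\mathbb{N}$, $$\mu_k(\rho)\le 4\pi^2\left(\frac{(N+2)k}{2\omega_N}\,\frac{\|\rho\|_\infty}{\|\rho\|_1}\right)^{2/N},$$ where $\omega_N$ is the volume of the unit ball of $\mathbb{R}^N$.
   Context: For a nonnegative $\rho\in L^1(\mathbb{R}^N)\cap L^\infty(\mathbb{R}^N)$, $\rho\not\equiv0$, and an integer $k\ge 0$, $$\mu_k(\rho):=\inf_{S\in\mathcal{S}_{k+1}}\ \max_{u\in S\setminus\{0\}}\frac{\int_{\mathbb{R}^N}\rho|\nabla u|^2dx}{\int_{\mathbb{R}^N}\rho u^2dx},$$ where $\mathcal{S}_{k+1}$ is the family of all linear subspaces of dimension $k+1$ of $\{u\cdot 1_{\{\rho>0\}}:u\in C_c^\infty(\mathbb{R}^N)\}$ (functions identified when equal almost everywhere; $\nabla u$ is the gradient of the smooth function $u$, which on $\{\rho>0\}$ depends only on $u\cdot 1_{\{\rho>0\}}$ up to null sets). *)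

theory Defs
  imports "HOL-Analysis.Analysis" "HOL-Probability.Essential_Supremum"
begin

primrec Ck :: "nat \<Rightarrow> ('a::euclidean_space \<Rightarrow> real) \<Rightarrow> bool" where
  "Ck 0 f \<longleftrightarrow> continuous_on UNIV f"
| "Ck (Suc m) f \<longleftrightarrow> (\<forall>x. f differentiable (at x)) \<and>
     (\<forall>b\<in>Basis. Ck m (\<lambda>x. frechet_derivative f (at x) b))"

definition Cc_infinity :: "('a::euclidean_space \<Rightarrow> real) set" where
  "Cc_infinity = {u. (\<forall>m. Ck m u) \<and> compact (closure {x. u x \<noteq> 0})}"

definition grad :: "('a::euclidean_space \<Rightarrow> real) \<Rightarrow> 'a \<Rightarrow> 'a" where
  "grad u x = (THE D. GDERIV u x :> D)"

definition Linf_norm :: "('a::euclidean_space \<Rightarrow> real) \<Rightarrow> ereal" where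
  "Linf_norm f = esssup lebesgue (\<lambda>x. ereal \<bar>f x\<bar>)"

text \<open>Real functions modulo equality Lebesgue-almost everywhere. Measurability is not imposed:
  only classes of functions in \<open>restricted_space\<close> below are ever used.\<close>

quotient_type (overloaded) 'a aefun = "'a::euclidean_space \<Rightarrow> real" /
  "\<lambda>f g. AE x in lebesgue. f x = g x"
  morphisms rep_aefun ae_class
proof (rule equivpI)
  show "reflp (\<lambda>f g :: 'a \<Rightarrow> real. AE x in lebesgue. f x = g x)"
    by (simp add: reflp_def)
  show "symp (\<lambda>f g :: 'a \<Rightarrow> real. AE x in lebesgue. f x = g x)"
    by (simp add: symp_def eq_commute)
  show "transp (\<lambda>f g :: 'a \<Rightarrow> real. AE x in lebesgue. f x = g x)"
    unfolding transp_def by (auto elim: eventually_elim2)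
qed

instantiation aefun :: (euclidean_space) real_vector
begin

lift_definition zero_aefun :: "'a aefun" is "\<lambda>x. 0" .

lift_definition plus_aefun :: "'a aefun \<Rightarrow> 'a aefun \<Rightarrow> 'a aefun"
  is "\<lambda>f g x. f x + g x"
  by (auto elim: eventually_elim2)

lift_definition minus_aefun :: "'a aefun \<Rightarrow> 'a aefun \<Rightarrow> 'a aefun"
  is "\<lambda>f g x. f x - g x"
  by (auto elim: eventually_elim2)

lift_definition uminus_aefun :: "'a aefun \<Rightarrow> 'a aefun" is "\<lambda>f x. - f x"
  by auto

lift_definition scaleR_aefun :: "real \<Rightarrow> 'a aefun \<Rightarrow> 'a aefun" is "\<lambda>c f x. c * f x"
  by (auto elim: eventually_mono)

instance
  by standard (transfer; simp add: algebra_simps)+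

end

definition restrict_pos :: "('a::euclidean_space \<Rightarrow> real) \<Rightarrow> ('a \<Rightarrow> real) \<Rightarrow> 'a aefun" where
  "restrict_pos \<rho> u = ae_class (\<lambda>x. u x * indicator {x. 0 < \<rho> x} x)"

definition restricted_space :: "('a::euclidean_space \<Rightarrow> real) \<Rightarrow> 'a aefun set" where
  "restricted_space \<rho> = restrict_pos \<rho> ` Cc_infinity"

text \<open>As \<open>dim\<close> is \<open>0\<close> on infinite-dimensional subspaces, \<open>d > 0\<close> forces finite dimension.\<close>

definition subspaces_of_dim :: "('a::euclidean_space \<Rightarrow> real) \<Rightarrow> nat \<Rightarrow> 'a aefun set set" where
  "subspaces_of_dim \<rho> d = {S. subspace S \<and> S \<subseteq> restricted_space \<rho> \<and> dim S = d}"

definition rayleigh :: "('a::euclidean_space \<Rightarrow> real) \<Rightarrow> ('a \<Rightarrow> real) \<Rightarrow> real" where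
  "rayleigh \<rho> u = (\<integral>x. \<rho> x * (norm (grad u x))\<^sup>2 \<partial>lebesgue) / (\<integral>x. \<rho> x * (u x)\<^sup>2 \<partial>lebesgue)"

text \<open>The supremum ranges over all smooth representatives \<open>u\<close> of the nonzero classes in \<open>S\<close>; the
  quotient is the same for all representatives of one class. It is a maximum, since \<open>S\<close> is
  finite-dimensional.\<close>

definition mu :: "nat \<Rightarrow> ('a::euclidean_space \<Rightarrow> real) \<Rightarrow> ereal" where
  "mu k \<rho> = (INF S \<in> subspaces_of_dim \<rho> (k + 1).
     SUP u \<in> {u \<in> Cc_infinity. restrict_pos \<rho> u \<in> S - {0}}. ereal (rayleigh \<rho> u))"

end

theory Submission
  imports Defs
begin

text \<open>
  Kroeger's argument without spectral theory. If \<open>M < mu k \<rho>\<close>, then on every finite-dimensional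
  space of test functions there are at most \<open>k\<close> mass-orthonormal functions \<open>\<phi>\<close> such that
  \<open>energy f \<ge> M (mass f - (\<Sum>\<phi>. (mass f \<phi>)\<^sup>2))\<close> for all \<open>f\<close> in the space. This is applied to
  the real and imaginary parts of \<open>\<kappa>(x) e\<^sup>i\<^sup>\<xi>\<^sup>x\<close>, where \<open>\<kappa>\<close> is a cutoff supported in the box of
  half-width \<open>L\<close> and \<open>\<xi>\<close> runs through the points with \<open>|\<xi>|\<^sup>2 < M\<close> of a translate of the lattice of
  mesh \<open>h = \<pi>/L\<close>. These waves are orthogonal on the box, so Bessel's inequality replaces Plancherel's
  theorem: summed over \<open>\<xi>\<close>, the projections onto the functions \<open>\<phi>\<close> contribute at most
  \<open>k (2L)\<^sup>N \<parallel>\<rho>\<parallel>\<^sub>\<infinity>\<close>. Integrating over all translates of the lattice and letting \<open>L \<rightarrow> \<infinity>\<close> gives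
  \<open>\<parallel>\<rho>\<parallel>\<^sub>1 \<integral> max 0 (M - |\<eta>|\<^sup>2) d\<eta> \<le> M k (2\<pi>)\<^sup>N \<parallel>\<rho>\<parallel>\<^sub>\<infinity>\<close>, which is the bound on \<open>M\<close>.
\<close>

section \<open>Simultaneous diagonalisation of two forms below a threshold\<close>

text \<open>For a general weight there is no compact embedding, so \<open>mu k \<rho>\<close> need
  not have eigenfunctions. On the span of finitely many test functions minima of Rayleigh quotients
  do exist, and one orthonormal family, of size at most \<open>k\<close> however large the span,
  serves all waves of a lattice at once; this is what permits the summation over frequencies. A
  second obstacle is that \<open>mu\<close> speaks of classes on the set where \<open>\<rho>\<close>
  is positive. Energy is a form on these classes only because the gradient of a test function
  vanishes almost everywhere on its zero set. The cutoff is the price for compact support: its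
  gradient costs \<open>O(1/L^2)\<close> per frequency, there are \<open>O(L^N)\<close> frequencies,
  and the cell volume \<open>h^N\<close> is \<open>O(1/L^N)\<close>, so the total cost vanishes in
  the limit. In the final constant \<open>2 * pi\<close> is \<open>2 * L * h\<close>, and
  \<open>(N + 2) / 2\<close> comes from the integral of the positive part of
  \<open>M - |\<eta>|^2\<close>, which is \<open>2 \<omega> M^(N/2 + 1) / (N + 2)\<close> with
  \<omega> the volume of the unit ball.\<close>

locale form_on =
  fixes V :: "'v::real_vector set" and Q :: "'v \<Rightarrow> 'v \<Rightarrow> real"
  assumes subspace_V: "subspace V"
    and sym: "\<lbrakk>u \<in> V; v \<in> V\<rbrakk> \<Longrightarrow> Q u v = Q v u"
    and add: "\<lbrakk>u \<in> V; v \<in> V; w \<in> V\<rbrakk> \<Longrightarrow> Q (u + v) w = Q u w + Q v w"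
    and scale: "\<lbrakk>u \<in> V; w \<in> V\<rbrakk> \<Longrightarrow> Q (c *\<^sub>R u) w = c * Q u w"
begin

lemma add_right: "\<lbrakk>u \<in> V; v \<in> V; w \<in> V\<rbrakk> \<Longrightarrow> Q w (u + v) = Q w u + Q w v"
  using add[of u v w] sym[of w u] sym[of w v] sym[of w "u + v"] subspace_add[OF subspace_V] by simp

lemma scale_right: "\<lbrakk>u \<in> V; w \<in> V\<rbrakk> \<Longrightarrow> Q w (c *\<^sub>R u) = c * Q w u"
  using scale[of u w c] sym[of w u] sym[of w "c *\<^sub>R u"] subspace_scale[OF subspace_V] by simp

lemma zero: "w \<in> V \<Longrightarrow> Q 0 w = 0"
  using scale[of w w 0] by simp

lemma sum_left:
  assumes "finite E" "E \<subseteq> V" "w \<in> V"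
  shows "Q (\<Sum>e\<in>E. c e *\<^sub>R e) w = (\<Sum>e\<in>E. c e * Q e w)"
  using assms(1,2)
proof induction
  case (insert x F)
  have "(\<Sum>e\<in>F. c e *\<^sub>R e) \<in> V"
    using insert.prems subspace_V by (intro subspace_sum subspace_scale) auto
  then show ?case
    using insert assms(3) subspace_V by (simp add: add scale subspace_scale)
qed (simp add: zero assms(3))

lemma sum_both:
  assumes "finite E" "E \<subseteq> V"
  shows "Q (\<Sum>e\<in>E. c e *\<^sub>R e) (\<Sum>e\<in>E. d e *\<^sub>R e) = (\<Sum>e\<in>E. \<Sum>f\<in>E. c e * d f * Q e f)"
proof -
  have V: "(\<Sum>e\<in>E. d e *\<^sub>R e) \<in> V"
    using assms subspace_V by (intro subspace_sum subspace_scale) auto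
  have "Q e (\<Sum>e\<in>E. d e *\<^sub>R e) = (\<Sum>f\<in>E. d f * Q e f)" if "e \<in> E" for e
    using sum_left[OF assms, of e d] sym[OF _ V, of e] that assms sym
    by (smt (verit, best) subset_iff sum.cong)
  then show ?thesis
    unfolding sum_left[OF assms V] by (simp add: sum_distrib_left mult.assoc)
qed

lemma square_add:
  assumes "u \<in> V" "v \<in> V"
  shows "Q (u + v) (u + v) = Q u u + 2 * Q u v + Q v v"
  using assms subspace_add[OF subspace_V] by (simp add: add add_right sym[of v u])

text \<open>Degenerate case of Cauchy-Schwarz. Applied to \<open>A - \<lambda> B\<close>, with
  \<lambda> the minimum of the Rayleigh quotient, it turns a minimiser into an eigenvector without
  differentiating.\<close>

lemma psd_isotropic:
  assumes psd: "\<And>v. v \<in> V \<Longrightarrow> 0 \<le> Q v v" and u: "u \<in> V" "Q u u = 0" and v: "v \<in> V"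
  shows "Q u v = 0"
proof (rule ccontr)
  assume ne: "Q u v \<noteq> 0"
  \<comment> \<open>Chosen so that \<open>2 * t * Q u v + Q v v = -1\<close>.\<close>
  define t where "t = - (Q v v + 1) / (2 * Q u v)"
  have tu: "t *\<^sub>R u \<in> V" using u subspace_V by (simp add: subspace_scale)
  have "0 \<le> Q (t *\<^sub>R u + v) (t *\<^sub>R u + v)"
    using tu v subspace_V by (intro psd subspace_add)
  also have "\<dots> = 2 * t * Q u v + Q v v"
    using tu u v by (simp add: square_add scale scale_right)
  also have "\<dots> = -1" using ne by (simp add: t_def field_simps)
  finally show False by simp
qed

end

lemma form_on_mono: "form_on V Q \<Longrightarrow> subspace W \<Longrightarrow> W \<subseteq> V \<Longrightarrow> form_on W Q"
  by (simp add: form_on_def subset_iff)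

lemma form_on_diff: "form_on V P \<Longrightarrow> form_on V Q \<Longrightarrow> form_on V (\<lambda>u v. P u v - c * Q u v)"
  by (auto simp: form_on_def algebra_simps)

text \<open>The sphere over which the Rayleigh quotient is minimised lives in the function space
  \<open>'v \<Rightarrow> real\<close> with its product topology, as coordinates with respect to a basis of \<open>W\<close>.\<close>

lemma rayleigh_minimiser:
  fixes A B :: "'v::real_vector \<Rightarrow> 'v \<Rightarrow> real"
  assumes A: "form_on W A" and B: "form_on W B"
    and pos: "\<And>v. v \<in> W \<Longrightarrow> v \<noteq> 0 \<Longrightarrow> 0 < B v v"
    and fin: "W \<subseteq> span G" "finite G" and ne: "\<exists>w\<in>W. w \<noteq> 0"
  shows "\<exists>\<phi>\<in>W. B \<phi> \<phi> = 1 \<and> (\<forall>v\<in>W. A \<phi> \<phi> * B v v \<le> A v v)"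
proof -
  interpret A: form_on W A by fact
  interpret B: form_on W B by fact
  obtain E where E: "E \<subseteq> W" "independent E" "W \<subseteq> span E"
    using basis_exists[of W] by metis
  have finE: "finite E"
    using independent_span_bound[OF fin(2) E(2)] E(1) fin(1) by blast
  have spanE: "span E = W"
    using E A.subspace_V by (simp add: span_minimal subset_antisym)
  define F where "F c = (\<Sum>e\<in>E. c e *\<^sub>R e)" for c :: "'v \<Rightarrow> real"
  have FW: "F c \<in> W" for c
    unfolding F_def using E A.subspace_V by (intro subspace_sum subspace_scale) auto
  \<comment> \<open>Coordinates outside \<open>E\<close> are pinned to \<open>0\<close>. Every
    factor is then compact, so Tychonoff applies although the index set is the whole type.\<close>
  define K where "K = Pi UNIV (\<lambda>e. if e \<in> E then {-1..1} else {0::real}) \<inter> {c. (\<Sum>e\<in>E. (c e)\<^sup>2) = 1}"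
  have cont_coord: "continuous_on S (\<lambda>c::'v \<Rightarrow> real. c e)" for S e
    by (rule continuous_on_subset[OF continuous_on_product_coordinates]) simp
  have "compactin (product_topology (\<lambda>e::'v. euclidean) UNIV) (PiE UNIV (\<lambda>e. if e \<in> E then {-1..1} else {0::real}))"
    unfolding compactin_PiE by auto
  then have "compact (Pi UNIV (\<lambda>e. if e \<in> E then {-1..1} else {0::real}))"
    by (simp add: euclidean_product_topology PiE_UNIV_domain)
  moreover have "closed {c::'v \<Rightarrow> real. (\<Sum>e\<in>E. (c e)\<^sup>2) = 1}"
    by (intro closed_Collect_eq continuous_intros cont_coord)
  ultimately have cK: "compact K"
    unfolding K_def by (rule compact_Int_closed)
  have F0: "F c \<noteq> 0" if "c \<in> K" for c
  proof
    assume "F c = 0"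
    then have "\<forall>e\<in>E. c e = 0"
      using E(2) finE unfolding F_def by (metis independentD subset_refl)
    then show False using that by (simp add: K_def)
  qed
  define q where "q c = A (F c) (F c) / B (F c) (F c)" for c
  have contq: "continuous_on K q"
  proof -
    have "B (F c) (F c) \<noteq> 0" if "c \<in> K" for c
      using pos[OF FW F0[OF that]] by simp
    then show ?thesis
      unfolding q_def F_def A.sum_both[OF finE E(1)] B.sum_both[OF finE E(1)]
      by (intro continuous_intros cont_coord) (auto simp: F_def B.sum_both[OF finE E(1)])
  qed
  \<comment> \<open>Both forms scale by \<open>t\<^sup>2\<close>, so the minimum of the quotient
    over \<open>K\<close> is its minimum over all nonzero vectors of \<open>W\<close>.\<close>
  have repr: "\<exists>c\<in>K. \<exists>t>0. v = t *\<^sub>R F c" if "v \<in> W" "v \<noteq> 0" for v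
  proof -
    have "v \<in> range (\<lambda>a. \<Sum>e\<in>E. a e *\<^sub>R e)"
      using that(1) spanE span_finite[OF finE] by simp
    then obtain a where a: "v = (\<Sum>e\<in>E. a e *\<^sub>R e)"
      by (rule rangeE)
    define s where "s = sqrt (\<Sum>e\<in>E. (a e)\<^sup>2)"
    have "\<exists>e\<in>E. a e \<noteq> 0" using that(2) a by (auto intro: ccontr)
    then have s2: "(\<Sum>e\<in>E. (a e)\<^sup>2) > 0"
      using finE by (meson sum_pos2 zero_le_power2 zero_less_power2)
    then have s: "s > 0" "s\<^sup>2 = (\<Sum>e\<in>E. (a e)\<^sup>2)" by (simp_all add: s_def)
    define c where "c e = (if e \<in> E then a e / s else 0)" for e
    have sum1: "(\<Sum>e\<in>E. (c e)\<^sup>2) = 1"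
      using s s2 by (simp add: c_def power_divide flip: sum_divide_distrib)
    have "\<bar>c e\<bar> \<le> 1" if "e \<in> E" for e
    proof -
      have "(c e)\<^sup>2 \<le> 1" using member_le_sum[of e E "\<lambda>e. (c e)\<^sup>2"] that finE sum1 by simp
      then show ?thesis by (simp add: abs_square_le_1)
    qed
    then have "\<forall>e\<in>E. c e \<in> {-1..1}" by (auto simp: abs_le_iff)
    then have "c \<in> K" using sum1 by (simp add: K_def Pi_iff) (simp add: c_def)
    moreover have "v = s *\<^sub>R F c"
      using s(1) by (simp add: a F_def c_def scaleR_sum_right)
    ultimately show ?thesis using s(1) by blast
  qed
  then have "K \<noteq> {}" using ne by blast
  from continuous_attains_inf[OF cK this contq] obtain c where
    c: "c \<in> K" "\<And>d. d \<in> K \<Longrightarrow> q c \<le> q d" by blast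
  define \<phi> where "\<phi> = (1 / sqrt (B (F c) (F c))) *\<^sub>R F c"
  have Bc: "B (F c) (F c) > 0" using pos[OF FW F0[OF c(1)]] .
  have W: "\<phi> \<in> W" unfolding \<phi>_def using FW A.subspace_V by (simp add: subspace_scale)
  have B1: "B \<phi> \<phi> = 1"
    using Bc FW A.subspace_V unfolding \<phi>_def
    by (simp add: B.scale B.scale_right subspace_scale field_simps flip: power2_eq_square)
  have A1: "A \<phi> \<phi> = q c"
    using Bc FW A.subspace_V unfolding \<phi>_def q_def
    by (simp add: A.scale A.scale_right subspace_scale field_simps flip: power2_eq_square)
  have "A \<phi> \<phi> * B v v \<le> A v v" if "v \<in> W" for v
  proof (cases "v = 0")
    case True
    then show ?thesis using that A.zero B.zero by simp
  next
    case False
    then obtain d t where d: "d \<in> K" "t > 0" "v = t *\<^sub>R F d" using repr \<open>v \<in> W\<close> by blast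
    have Bd: "B (F d) (F d) > 0" using pos[OF FW F0[OF d(1)]] .
    have "q c * B (F d) (F d) \<le> A (F d) (F d)"
      using c(2)[OF d(1)] Bd by (simp add: q_def[of d] pos_le_divide_eq)
    then have "t * t * (q c * B (F d) (F d)) \<le> t * t * A (F d) (F d)"
      using d(2) by (intro mult_left_mono) auto
    then show ?thesis
      using FW A.subspace_V unfolding A1 d(3)
      by (simp add: A.scale A.scale_right B.scale B.scale_right subspace_scale mult_ac)
  qed
  then show ?thesis using W B1 by blast
qed

text \<open>A maximal orthonormal set of eigenvectors with eigenvalue below \<open>M\<close> has at most \<open>k\<close>
  elements, and on its orthogonal complement the Rayleigh quotient is at least \<open>M\<close>.\<close>

lemma form_lower_bound:
  fixes A B :: "'v::real_vector \<Rightarrow> 'v \<Rightarrow> real"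
  assumes A: "form_on V A" and B: "form_on V B"
    and posB: "\<And>v. v \<in> V \<Longrightarrow> v \<noteq> 0 \<Longrightarrow> 0 < B v v" and posA: "\<And>v. v \<in> V \<Longrightarrow> 0 \<le> A v v"
    and fin: "V \<subseteq> span G" "finite G"
    and H: "\<And>S. \<lbrakk>subspace S; S \<subseteq> V; dim S = k + 1\<rbrakk> \<Longrightarrow> \<exists>u\<in>S. M * B u u < A u u"
  shows "\<exists>\<Phi>. finite \<Phi> \<and> \<Phi> \<subseteq> V \<and> card \<Phi> \<le> k \<and> (\<forall>\<phi>\<in>\<Phi>. B \<phi> \<phi> = 1) \<and>
    (\<forall>f\<in>V. M * (B f f - (\<Sum>\<phi>\<in>\<Phi>. (B f \<phi>)\<^sup>2)) \<le> A f f)"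
proof -
  interpret A: form_on V A by fact
  interpret B: form_on V B by fact
  have sV: "subspace V" by (rule A.subspace_V)
  \<comment> \<open>\<open>B\<close>-orthonormal families of weak eigenvectors of \<open>A\<close>
    relative to \<open>B\<close>, with eigenvalue \<open>A \<phi> \<phi>\<close> below
    \<open>M\<close>. The eigenvalue equation is tested against all of \<open>V\<close>.\<close>
  define good where "good \<Phi> \<longleftrightarrow> finite \<Phi> \<and> \<Phi> \<subseteq> V \<and>
      (\<forall>\<phi>\<in>\<Phi>. \<forall>\<psi>\<in>\<Phi>. B \<phi> \<psi> = (if \<phi> = \<psi> then 1 else 0)) \<and>
      (\<forall>\<phi>\<in>\<Phi>. A \<phi> \<phi> < M \<and> (\<forall>v\<in>V. A \<phi> v = A \<phi> \<phi> * B \<phi> v))" for \<Phi>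
  have expand: "B (\<Sum>\<phi>\<in>\<Phi>. c \<phi> *\<^sub>R \<phi>) (\<Sum>\<phi>\<in>\<Phi>. c \<phi> *\<^sub>R \<phi>) = (\<Sum>\<phi>\<in>\<Phi>. (c \<phi>)\<^sup>2)"
     "A (\<Sum>\<phi>\<in>\<Phi>. c \<phi> *\<^sub>R \<phi>) (\<Sum>\<phi>\<in>\<Phi>. c \<phi> *\<^sub>R \<phi>) = (\<Sum>\<phi>\<in>\<Phi>. A \<phi> \<phi> * (c \<phi>)\<^sup>2)"
    if g: "good \<Phi>" for \<Phi> c
  proof -
    have f: "finite \<Phi>" "\<Phi> \<subseteq> V" and o: "\<And>\<phi> \<psi>. \<phi> \<in> \<Phi> \<Longrightarrow> \<psi> \<in> \<Phi> \<Longrightarrow> B \<phi> \<psi> = (if \<phi> = \<psi> then 1 else 0)"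
      and a: "\<And>\<phi> \<psi>. \<phi> \<in> \<Phi> \<Longrightarrow> \<psi> \<in> \<Phi> \<Longrightarrow> A \<phi> \<psi> = (if \<phi> = \<psi> then A \<phi> \<phi> else 0)"
      using g unfolding good_def by auto
    have "(\<Sum>e\<in>\<Phi>. \<Sum>f\<in>\<Phi>. c e * c f * B e f) = (\<Sum>e\<in>\<Phi>. \<Sum>f\<in>\<Phi>. if e = f then (c e)\<^sup>2 else 0)"
      by (intro sum.cong refl) (auto simp: o power2_eq_square)
    then show "B (\<Sum>\<phi>\<in>\<Phi>. c \<phi> *\<^sub>R \<phi>) (\<Sum>\<phi>\<in>\<Phi>. c \<phi> *\<^sub>R \<phi>) = (\<Sum>\<phi>\<in>\<Phi>. (c \<phi>)\<^sup>2)"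
      unfolding B.sum_both[OF f] by (simp add: f)
    have "(\<Sum>e\<in>\<Phi>. \<Sum>f\<in>\<Phi>. c e * c f * A e f) = (\<Sum>e\<in>\<Phi>. \<Sum>f\<in>\<Phi>. if e = f then A e e * (c e)\<^sup>2 else 0)"
    proof (intro sum.cong refl)
      fix e f assume "e \<in> \<Phi>" "f \<in> \<Phi>"
      then show "c e * c f * A e f = (if e = f then A e e * (c e)\<^sup>2 else 0)"
        using a[of e f] by (cases "e = f") (simp_all add: power2_eq_square)
    qed
    then show "A (\<Sum>\<phi>\<in>\<Phi>. c \<phi> *\<^sub>R \<phi>) (\<Sum>\<phi>\<in>\<Phi>. c \<phi> *\<^sub>R \<phi>) = (\<Sum>\<phi>\<in>\<Phi>. A \<phi> \<phi> * (c \<phi>)\<^sup>2)"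
      unfolding A.sum_both[OF f] by (simp add: f)
  qed
  have indep: "independent \<Phi>" if g: "good \<Phi>" for \<Phi>
  proof (rule independent_if_scalars_zero)
    show f: "finite \<Phi>" using g by (simp add: good_def)
    fix c \<phi> assume 0: "(\<Sum>\<phi>\<in>\<Phi>. c \<phi> *\<^sub>R \<phi>) = 0" and p: "\<phi> \<in> \<Phi>"
    have "(\<Sum>\<phi>\<in>\<Phi>. (c \<phi>)\<^sup>2) = 0"
      using expand(1)[OF g, of c] B.zero[of 0] sV by (simp add: 0 subspace_0)
    then show "c \<phi> = 0" using f p by (simp add: sum_nonneg_eq_0_iff)
  qed
  \<comment> \<open>Both forms are diagonal on a good family, so \<open>A \<le> M B\<close> on its
    span. A span of dimension \<open>k + 1\<close> would contradict \<open>H\<close>.\<close>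
  have card_le: "card \<Phi> \<le> k" if g: "good \<Phi>" for \<Phi>
  proof (rule ccontr)
    assume "\<not> card \<Phi> \<le> k"
    then obtain \<Psi> where Psi: "\<Psi> \<subseteq> \<Phi>" "card \<Psi> = k + 1" "finite \<Psi>"
      using obtain_subset_with_card_n[of "k + 1" \<Phi>] by auto
    have gP: "good \<Psi>" using g Psi unfolding good_def by (meson subset_eq)
    have lt: "\<Psi> \<subseteq> V" "\<And>\<phi>. \<phi> \<in> \<Psi> \<Longrightarrow> A \<phi> \<phi> \<le> M" using gP unfolding good_def by (blast, force)
    have "span \<Psi> \<subseteq> V" using lt(1) sV by (rule span_minimal)
    moreover have "dim (span \<Psi>) = k + 1"
      using dim_eq_card_independent[OF indep[OF gP]] Psi by simp
    ultimately obtain u where u: "u \<in> span \<Psi>" "M * B u u < A u u"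
      using H[OF subspace_span] by blast
    from u(1) have "u \<in> range (\<lambda>c. \<Sum>\<phi>\<in>\<Psi>. c \<phi> *\<^sub>R \<phi>)"
      unfolding span_finite[OF Psi(3)] .
    then obtain c where c: "u = (\<Sum>\<phi>\<in>\<Psi>. c \<phi> *\<^sub>R \<phi>)"
      by (rule rangeE)
    have "A u u \<le> M * B u u"
      unfolding c expand[OF gP] sum_distrib_left
      by (intro sum_mono mult_right_mono lt(2)) auto
    then show False using u by simp
  qed
  have "good {}" by (simp add: good_def)
  \<comment> \<open>The uniform bound on cardinalities makes a family of greatest size
    exist.\<close>
  then have "\<exists>\<Phi>. good \<Phi> \<and> (\<forall>\<Psi>. good \<Psi> \<longrightarrow> card \<Psi> \<le> card \<Phi>)"
    using card_le by (intro Lattices_Big.ex_has_greatest_nat[of good "{}" card "k + 1"]) (auto simp: less_Suc_eq_le)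
  then obtain \<Phi> where g: "good \<Phi>" and max: "\<And>\<Psi>. good \<Psi> \<Longrightarrow> card \<Psi> \<le> card \<Phi>" by blast
  have f: "finite \<Phi>" "\<Phi> \<subseteq> V" and o: "\<And>\<phi> \<psi>. \<phi> \<in> \<Phi> \<Longrightarrow> \<psi> \<in> \<Phi> \<Longrightarrow> B \<phi> \<psi> = (if \<phi> = \<psi> then 1 else 0)"
    and eig: "\<And>\<phi> v. \<phi> \<in> \<Phi> \<Longrightarrow> v \<in> V \<Longrightarrow> A \<phi> v = A \<phi> \<phi> * B \<phi> v"
    using g unfolding good_def by auto
  define W where "W = {v \<in> V. \<forall>\<phi>\<in>\<Phi>. B v \<phi> = 0}"
  have WV: "W \<subseteq> V" by (auto simp: W_def)
  have sW: "subspace W"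
    unfolding W_def subspace_def using sV f B.zero B.add B.scale
    by (auto simp: subspace_0 subspace_add subspace_scale subset_iff)
  have AW: "form_on W A" and BW: "form_on W B"
    using form_on_mono[OF A sW WV] form_on_mono[OF B sW WV] by auto
  define P where "P v = (\<Sum>\<phi>\<in>\<Phi>. B v \<phi> *\<^sub>R \<phi>)" for v
  have PV: "P v \<in> V" for v
    unfolding P_def using f sV by (intro subspace_sum subspace_scale) auto
  have PW: "v - P v \<in> W" if v: "v \<in> V" for v
  proof -
    have "B (v - P v) \<psi> = 0" if p: "\<psi> \<in> \<Phi>" for \<psi>
    proof -
      have "B (P v) \<psi> = (\<Sum>\<phi>\<in>\<Phi>. B v \<phi> * B \<phi> \<psi>)"
        unfolding P_def using f p by (intro B.sum_left) auto
      also have "\<dots> = (\<Sum>\<phi>\<in>\<Phi>. if \<phi> = \<psi> then B v \<phi> else 0)"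
        by (intro sum.cong) (auto simp: o p)
      finally have "B (P v) \<psi> = B v \<psi>" using f p by simp
      moreover have "B ((v - P v) + P v) \<psi> = B (v - P v) \<psi> + B (P v) \<psi>"
        using v p PV f sV by (intro B.add) (auto simp: subspace_diff)
      ultimately show ?thesis by simp
    qed
    then show ?thesis using v PV sV by (simp add: W_def subspace_diff)
  qed
  \<comment> \<open>If the bound failed, the minimiser on \<open>W\<close> would be an eigenvector
    with eigenvalue below \<open>M\<close>, and adding it would enlarge the maximal family.\<close>
  have W_bound: "M * B v v \<le> A v v" if v: "v \<in> W" for v
  proof (rule ccontr)
    assume less: "\<not> M * B v v \<le> A v v"
    then have "v \<noteq> 0" using A.zero B.zero sV by (auto simp: subspace_0)
    then have "\<exists>\<phi>\<in>W. B \<phi> \<phi> = 1 \<and> (\<forall>v\<in>W. A \<phi> \<phi> * B v v \<le> A v v)"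
      using v WV fin posB by (intro rayleigh_minimiser[OF AW BW]) auto
    then obtain \<phi> where ph: "\<phi> \<in> W" "B \<phi> \<phi> = 1" and min: "\<And>v. v \<in> W \<Longrightarrow> A \<phi> \<phi> * B v v \<le> A v v"
      by blast
    have phV: "\<phi> \<in> V" using ph WV by auto
    have "A \<phi> \<phi> * B v v < M * B v v" using min[OF v] less by linarith
    moreover have "0 < B v v" using v WV posB \<open>v \<noteq> 0\<close> by auto
    ultimately have ltM: "A \<phi> \<phi> < M" by simp
    \<comment> \<open>Minimality makes \<open>C\<close> positive semidefinite on \<open>W\<close>,
      and \<open>C \<phi> \<phi> = 0\<close> because \<open>B \<phi> \<phi> = 1\<close>.\<close>
    define C where "C u v = A u v - A \<phi> \<phi> * B u v" for u v
    have "form_on W C" unfolding C_def by (rule form_on_diff[OF AW BW])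
    then interpret C: form_on W C .
    have eigW: "A \<phi> w = A \<phi> \<phi> * B \<phi> w" if w: "w \<in> W" for w
      using C.psd_isotropic[of \<phi> w] min ph w by (simp add: C_def)
    \<comment> \<open>So far the equation holds against \<open>W\<close> only. The component of a
      vector along \<Phi> is orthogonal to \<phi> for \<open>B\<close> by the definition of
      \<open>W\<close>, and then for \<open>A\<close> by the eigenvalue equations of \<Phi>.\<close>
    have eigV: "A \<phi> w = A \<phi> \<phi> * B \<phi> w" if w: "w \<in> V" for w
    proof -
      have 0: "B \<phi> (P w) = 0" "A \<phi> (P w) = 0"
      proof -
        have z: "B \<psi> \<phi> = 0" if "\<psi> \<in> \<Phi>" for \<psi>
          using ph that f phV B.sym by (auto simp: W_def)
        have "A \<psi> \<phi> = 0" if "\<psi> \<in> \<Phi>" for \<psi>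
          using eig[OF that phV] z[OF that] by simp
        then have "B (P w) \<phi> = 0" "A (P w) \<phi> = 0"
          unfolding P_def B.sum_left[OF f phV] A.sum_left[OF f phV]
          using z by simp_all
        then show "B \<phi> (P w) = 0" "A \<phi> (P w) = 0"
          using A.sym B.sym PV phV by metis+
      qed
      have d: "w - P w \<in> V" using PW[OF w] WV by auto
      have "A \<phi> ((w - P w) + P w) = A \<phi> (w - P w)" "B \<phi> ((w - P w) + P w) = B \<phi> (w - P w)"
        by (subst A.add_right[OF d PV phV] B.add_right[OF d PV phV], simp add: 0)+
      then show ?thesis using eigW[OF PW[OF w]] by simp
    qed
    have nin: "\<phi> \<notin> \<Phi>" using ph by (auto simp: W_def)
    have "good (insert \<phi> \<Phi>)"
      unfolding good_def
    proof (intro conjI ballI)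
      show "finite (insert \<phi> \<Phi>)" "insert \<phi> \<Phi> \<subseteq> V" using f phV by auto
      fix \<psi> assume ps: "\<psi> \<in> insert \<phi> \<Phi>"
      show "A \<psi> \<psi> < M" using ps ltM g unfolding good_def by blast
      show "A \<psi> v = A \<psi> \<psi> * B \<psi> v" if "v \<in> V" for v
        using ps eigV eig that by blast
      fix \<eta> assume ch: "\<eta> \<in> insert \<phi> \<Phi>"
      show "B \<psi> \<eta> = (if \<psi> = \<eta> then 1 else 0)"
      proof -
        have "B \<phi> \<psi> = 0" "B \<psi> \<phi> = 0" if "\<psi> \<in> \<Phi>" for \<psi>
          using ph(1) that B.sym[OF phV, of \<psi>] f(2) by (auto simp: W_def)
        then show ?thesis using ps ch ph(2) nin o by (metis insertE)
      qed
    qed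
    then show False using max[of "insert \<phi> \<Phi>"] nin f by simp
  qed
  have "M * (B u u - (\<Sum>\<phi>\<in>\<Phi>. (B u \<phi>)\<^sup>2)) \<le> A u u" if u: "u \<in> V" for u
  proof -
    define w where "w = u - P u"
    have w: "w \<in> W" "w \<in> V" unfolding w_def using PW[OF u] WV by auto
    have 0: "B (P u) w = 0" "A (P u) w = 0"
    proof -
      have "B w \<psi> = 0" if "\<psi> \<in> \<Phi>" for \<psi>
        using w that by (simp add: W_def)
      then have B0: "B \<psi> w = 0" if "\<psi> \<in> \<Phi>" for \<psi>
        using B.sym[OF w(2)] f(2) that by (metis subsetD)
      then have "A \<psi> w = 0" if "\<psi> \<in> \<Phi>" for \<psi>
        using eig[OF that w(2)] that by simp
      then show "B (P u) w = 0" "A (P u) w = 0"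
        unfolding P_def B.sum_left[OF f w(2)] A.sum_left[OF f w(2)]
        using B0 by simp_all
    qed
    \<comment> \<open>Pythagoras for both forms. \<open>B u u\<close> minus the squared coefficients
      is \<open>B w w\<close>, and the term \<open>A (P u) (P u) \<ge> 0\<close> is dropped.\<close>
    have "B u u = B (P u) (P u) + B w w" "A u u = A (P u) (P u) + A w w"
      using B.square_add[OF PV w(2), of u] A.square_add[OF PV w(2), of u] 0 by (simp_all add: w_def)
    moreover have "B (P u) (P u) = (\<Sum>\<phi>\<in>\<Phi>. (B u \<phi>)\<^sup>2)"
      unfolding P_def using expand(1)[OF g] .
    ultimately show ?thesis using W_bound[OF w(1)] posA[OF PV, of u] by simp
  qed
  then show ?thesis
    using f o card_le[OF g] by (intro exI[of _ \<Phi>]) auto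
qed

section \<open>Smooth functions and cutoffs\<close>

lemma Ck_SucI:
  assumes "\<And>x. (f has_derivative f' x) (at x)" "\<And>b. b \<in> Basis \<Longrightarrow> Ck m (\<lambda>x. f' x b)"
  shows "Ck (Suc m) f"
proof -
  have "frechet_derivative f (at x) = f' x" for x
    using frechet_derivative_at[OF assms(1)] by metis
  then show ?thesis using assms by (auto simp: differentiable_def)
qed

lemma Ck_has_derivative: "Ck (Suc m) f \<Longrightarrow> (f has_derivative frechet_derivative f (at x)) (at x)"
  by (simp add: frechet_derivative_works[symmetric])

lemma Ck_partial: "Ck (Suc m) f \<Longrightarrow> b \<in> Basis \<Longrightarrow> Ck m (\<lambda>x. frechet_derivative f (at x) b)"
  by simp

lemma Ck_continuous: "Ck m f \<Longrightarrow> continuous_on UNIV f"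
  by (cases m) (simp_all add: continuous_at_imp_continuous_on differentiable_imp_continuous_within)

lemma Ck_SucD: "Ck (Suc m) f \<Longrightarrow> Ck m f"
proof (induction m arbitrary: f)
  case 0
  then show ?case using Ck_continuous[OF 0] by simp
next
  case (Suc m)
  show ?case
    using Suc.prems Suc.IH[OF Ck_partial[OF Suc.prems]] by (simp only: Ck.simps(2)) blast
qed

lemma Ck_const: "Ck m (\<lambda>x. c)"
proof (induction m arbitrary: c)
  case (Suc m)
  show ?case by (rule Ck_SucI[where f' = "\<lambda>x h. 0"]) (auto intro: Suc)
qed simp

lemma Ck_inner: "Ck m (\<lambda>x. x \<bullet> a)"
proof (cases m)
  case (Suc n)
  show ?thesis unfolding Suc
    by (rule Ck_SucI[where f' = "\<lambda>x h. h \<bullet> a"]) (auto intro!: derivative_eq_intros Ck_const)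
qed (simp add: continuous_on_inner)

lemma Ck_add: "Ck m f \<Longrightarrow> Ck m g \<Longrightarrow> Ck m (\<lambda>x. f x + g x)"
proof (induction m arbitrary: f g)
  case 0
  then show ?case by (auto intro: continuous_on_add)
next
  case (Suc m)
  show ?case
    by (rule Ck_SucI[OF has_derivative_add[OF Ck_has_derivative[OF Suc.prems(1)] Ck_has_derivative[OF Suc.prems(2)]]])
       (intro Suc.IH Ck_partial[OF Suc.prems(1)] Ck_partial[OF Suc.prems(2)])
qed

lemma Ck_mult: "Ck m f \<Longrightarrow> Ck m g \<Longrightarrow> Ck m (\<lambda>x. f x * g x)"
proof (induction m arbitrary: f g)
  case 0
  then show ?case by (auto intro: continuous_on_mult)
next
  case (Suc m)
  show ?case
    by (rule Ck_SucI[OF has_derivative_mult[OF Ck_has_derivative[OF Suc.prems(1)] Ck_has_derivative[OF Suc.prems(2)]]])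
       (intro Ck_add Suc.IH Ck_partial[OF Suc.prems(1)] Ck_partial[OF Suc.prems(2)] Ck_SucD[OF Suc.prems(1)] Ck_SucD[OF Suc.prems(2)])
qed

lemma Ck_sum: "(\<And>i. i \<in> I \<Longrightarrow> Ck m (f i)) \<Longrightarrow> Ck m (\<lambda>x. \<Sum>i\<in>I. f i x)"
  by (induction I rule: infinite_finite_induct) (simp_all add: Ck_const Ck_add)

lemma Ck_compose:
  fixes g :: "real \<Rightarrow> real"
  shows "Ck m g \<Longrightarrow> Ck m f \<Longrightarrow> Ck m (\<lambda>x. g (f x))"
proof (induction m arbitrary: f g)
  case 0
  then show ?case by (auto intro: continuous_on_compose2)
next
  case (Suc m)
  have lin: "frechet_derivative g (at y) h = h * frechet_derivative g (at y) 1" for y h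
    using linear_scale[OF has_derivative_linear[OF Ck_has_derivative[OF Suc.prems(1)]], of y h 1] by simp
  have "((\<lambda>x. g (f x)) has_derivative
      (\<lambda>h. frechet_derivative f (at x) h * frechet_derivative g (at (f x)) 1)) (at x)" for x
    using has_derivative_compose[OF Ck_has_derivative[OF Suc.prems(2)] Ck_has_derivative[OF Suc.prems(1)]]
    by (subst (asm) lin)
  then show ?case
    by (rule Ck_SucI)
       (intro Ck_mult Ck_partial[OF Suc.prems(2)] Suc.IH[OF Ck_partial[OF Suc.prems(1)] Ck_SucD[OF Suc.prems(2)]], simp_all)
qed

lemma Ck_real_SucI:
  fixes g :: "real \<Rightarrow> real"
  assumes "\<And>t. (g has_real_derivative g' t) (at t)" "Ck m g'"
  shows "Ck (Suc m) g"
  using assms by (intro Ck_SucI[where f' = "\<lambda>t h. g' t * h"]) (simp_all add: has_field_derivative_def)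

lemma Ck_cos_sin: "Ck m (cos :: real \<Rightarrow> real) \<and> Ck m (sin :: real \<Rightarrow> real)"
proof (induction m)
  case (Suc m)
  have "Ck m (\<lambda>x::real. -1 * sin x)" using Suc by (intro Ck_mult Ck_const) auto
  then have "Ck m (\<lambda>x::real. - sin x)" by simp
  then show ?case
    using Ck_real_SucI[OF DERIV_cos] Ck_real_SucI[OF DERIV_sin] Suc by blast
qed (simp add: continuous_on_cos continuous_on_sin)

text \<open>For \<open>n = 0\<close> this is the classical smooth function that is flat at
  \<open>0\<close>. The powers in the denominator make the family closed under differentiation up to
  linear combinations, so one induction on the order gives smoothness of all members.\<close>

definition bump :: "nat \<Rightarrow> real \<Rightarrow> real" where
  "bump n t = (if 0 < t then exp (- (1 / t)) / t ^ n else 0)"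

lemma DERIV_bump: "(bump n has_real_derivative bump (n + 2) t - real n * bump (n + 1) t) (at t)"
proof (cases t "0::real" rule: linorder_cases)
  case less
  have "((\<lambda>t. 0) has_real_derivative 0) (at t)" by simp
  then have "(bump n has_real_derivative 0) (at t)"
    by (rule has_field_derivative_transform_within_open[where S = "{..<0}"]) (use less in \<open>auto simp: bump_def\<close>)
  then show ?thesis using less by (simp add: bump_def)
next
  case greater
  \<comment> \<open>The power is moved into the exponent, so that a single chain rule covers every
    \<open>n\<close>.\<close>
  have eq: "exp (- (1 / t)) / t ^ m = exp (- (1 / t) - real m * ln t)" if "0 < t" for t :: real and m
    using that by (simp add: exp_diff exp_of_nat_mult)
  have "((\<lambda>t. exp (- (1 / t) - real n * ln t)) has_real_derivative
      exp (- (1 / t) - real n * ln t) * (1 / t\<^sup>2 - real n / t)) (at t)"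
    using greater by (auto intro!: derivative_eq_intros simp: power2_eq_square[of t])
  moreover have "exp (- (1 / t) - real n * ln t) * (1 / t\<^sup>2 - real n / t) = bump (n + 2) t - real n * bump (n + 1) t"
    using greater by (simp add: bump_def eq[symmetric] right_diff_distrib power2_eq_square mult_ac)
  ultimately have "((\<lambda>t. exp (- (1 / t) - real n * ln t)) has_real_derivative
      bump (n + 2) t - real n * bump (n + 1) t) (at t)" by simp
  then show ?thesis
    by (rule has_field_derivative_transform_within_open[where S = "{0<..}"])
       (use greater in \<open>auto simp: bump_def eq\<close>)
next
  case equal
  \<comment> \<open>The right-hand difference quotient \<open>bump n t / t\<close> at
    \<open>0\<close> is \<open>x ^ Suc n / exp x\<close> with \<open>x = 1 / t\<close>.\<close>
  have "((\<lambda>x::real. x ^ Suc n / exp x) \<longlongrightarrow> 0) at_top" by (rule tendsto_power_div_exp_0)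
  then have "((\<lambda>t::real. inverse t ^ Suc n / exp (inverse t)) \<longlongrightarrow> 0) (at_right 0)"
    by (rule filterlim_compose) (rule filterlim_inverse_at_top_right)
  then have "((\<lambda>t. bump n t / t) \<longlongrightarrow> 0) (at_right 0)"
    by (rule Lim_transform_eventually)
       (auto simp: eventually_at_filter bump_def field_simps exp_minus intro!: always_eventually)
  moreover have "((\<lambda>t. bump n t / t) \<longlongrightarrow> 0) (at_left 0)"
    by (rule Lim_transform_eventually[OF tendsto_const])
       (auto simp: eventually_at_filter bump_def intro!: always_eventually)
  ultimately have "((\<lambda>t. bump n t / t) \<longlongrightarrow> 0) (at 0)"
    by (simp add: filterlim_split_at)
  then show ?thesis unfolding equal DERIV_def by (simp add: bump_def)
qed

lemma Ck_bump: "Ck m (bump n)"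
proof (induction m arbitrary: n)
  case 0
  then show ?case
    by (auto simp: continuous_on_eq_continuous_at intro: DERIV_isCont[OF DERIV_bump])
next
  case (Suc m)
  have "Ck m (\<lambda>t. bump (n + 2) t + (- real n) * bump (n + 1) t)"
    by (intro Ck_add Ck_mult Ck_const Suc)
  then show ?case by (intro Ck_real_SucI[OF DERIV_bump]) simp
qed

text \<open>Using \<open>x \<bullet> x\<close> instead of the norm avoids a singularity at the
  origin. The factor \<open>exp 1\<close> makes the value there \<open>1\<close>, hence the
  pointwise limit for large \<open>R\<close> as well. The support lies in the ball of radius
  \<open>R\<close>, and so in the box of half-width \<open>R\<close>.\<close>

definition cutoff :: "real \<Rightarrow> 'a::euclidean_space \<Rightarrow> real" where
  "cutoff R x = exp 1 * bump 0 (1 - (x \<bullet> x) / R\<^sup>2)"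

lemma Ck_cutoff: "Ck m (cutoff R)"
proof -
  have "Ck m (\<lambda>x::'a. exp 1 * bump 0 (1 + (- 1 / R\<^sup>2) * (\<Sum>b\<in>Basis. (x \<bullet> b) * (x \<bullet> b))))"
    by (intro Ck_mult Ck_const Ck_compose[OF Ck_bump] Ck_add Ck_sum Ck_inner)
  then show ?thesis unfolding cutoff_def[abs_def] euclidean_inner[symmetric] by simp
qed

lemma cutoff_eq_0:
  assumes "0 < R" "R \<le> norm x"
  shows "cutoff R x = 0"
proof -
  have "R\<^sup>2 \<le> x \<bullet> x" using power_mono[of R "norm x" 2] assms by (simp add: power2_norm_eq_inner)
  then show ?thesis using assms by (simp add: cutoff_def bump_def field_simps)
qed

lemma cutoff_bounds: "0 \<le> cutoff R x" "cutoff R x \<le> 1"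
proof -
  show "0 \<le> cutoff R x" by (simp add: cutoff_def bump_def)
  have "exp 1 * exp (- (1 / s)) \<le> 1" if "0 < s" "s \<le> 1" for s :: real
    using that by (simp add: field_simps flip: exp_add)
  then show "cutoff R x \<le> 1" by (simp add: cutoff_def bump_def)
qed

lemma GDERIV_cutoff:
  "GDERIV (cutoff R) x :> (- 2 * exp 1 * bump 2 (1 - (x \<bullet> x) / R\<^sup>2) / R\<^sup>2) *\<^sub>R x"
proof -
  have "((\<lambda>x::'a. 1 - c * (x \<bullet> x)) has_derivative (\<lambda>h. - c * (2 * (h \<bullet> x)))) (at x)" for c
    by (auto intro!: derivative_eq_intros simp: inner_commute algebra_simps)
  from this[of "1 / R\<^sup>2"]
  have d: "((\<lambda>x::'a. 1 - (x \<bullet> x) / R\<^sup>2) has_derivative (\<lambda>h. - 2 * (h \<bullet> x) / R\<^sup>2)) (at x)"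
    by simp
  have "((\<lambda>t. exp 1 * bump 0 t) has_derivative (\<lambda>h. exp 1 * bump 2 (1 - (x \<bullet> x) / R\<^sup>2) * h)) (at (1 - (x \<bullet> x) / R\<^sup>2))"
    using DERIV_cmult[OF DERIV_bump[of 0 "1 - (x \<bullet> x) / R\<^sup>2"], of "exp 1"]
    by (simp add: has_field_derivative_def mult.assoc[abs_def] numeral_2_eq_2[symmetric])
  from has_derivative_compose[OF d this] show ?thesis
    by (simp add: gderiv_def cutoff_def[abs_def] inner_commute mult_ac)
qed

text \<open>The rate \<open>1 / R\<close> is what makes the cost of the cutoff vanish. Where the
  gradient is nonzero, \<open>norm x \<le> R\<close>, and \<open>exp y \<ge> y\<^sup>2 / 2\<close>
  at \<open>y = 1 / s\<close> bounds \<open>bump 2 s\<close> by \<open>2\<close>.\<close>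

lemma norm_gradient_cutoff_le:
  assumes R: "0 < R" and D: "GDERIV (cutoff R) x :> D"
  shows "norm D \<le> 4 * exp 1 / R"
proof -
  define s where "s = 1 - (x \<bullet> x) / R\<^sup>2"
  have D: "D = (- 2 * exp 1 * bump 2 s / R\<^sup>2) *\<^sub>R x"
    using has_derivative_unique[OF D[unfolded gderiv_def] GDERIV_cutoff[unfolded gderiv_def]]
    unfolding s_def by (metis inner_commute vector_eq_rdot)
  show ?thesis
  proof (cases "0 < s")
    case False
    then show ?thesis using R by (simp add: D bump_def)
  next
    case True
    then have "(norm x)\<^sup>2 \<le> R\<^sup>2" using R by (simp add: s_def field_simps power2_norm_eq_inner)
    then have nx: "norm x \<le> R" using R by (simp add: abs_le_square_iff[symmetric])
    have "1 + 1 / s + (1 / s)\<^sup>2 / 2 \<le> exp (1 / s)"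
      using True by (intro exp_lower_Taylor_quadratic) simp
    then have "(1 / s)\<^sup>2 \<le> 2 * exp (1 / s)" using True by (smt (verit) divide_pos_pos field_sum_of_halves)
    then have "bump 2 s \<le> 2" "0 \<le> bump 2 s"
      using True by (simp_all add: bump_def exp_minus field_simps)
    then have "norm D \<le> (2 * exp 1 * 2 / R\<^sup>2) * R"
      unfolding D norm_scaleR using R nx
      by (intro mult_mono) (auto simp: abs_mult divide_right_mono)
    then show ?thesis using R by (simp add: power2_eq_square)
  qed
qed

lemma cutoff_tendsto:
  assumes "filterlim R at_top F"
  shows "((\<lambda>j. cutoff (R j) x) \<longlongrightarrow> 1) F"
proof -
  have "((\<lambda>j. 1 - (x \<bullet> x) / (R j)\<^sup>2) \<longlongrightarrow> 1 - 0) F"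
    by (intro tendsto_diff tendsto_const tendsto_divide_0[OF tendsto_const]
        filterlim_at_top_imp_at_infinity filterlim_pow_at_top assms) simp
  then have "((\<lambda>j. bump 0 (1 - (x \<bullet> x) / (R j)\<^sup>2)) \<longlongrightarrow> bump 0 1) F"
    by (intro isCont_tendsto_compose[OF DERIV_isCont[OF DERIV_bump]]) simp
  from tendsto_mult_left[OF this, of "exp 1"] show ?thesis
    by (simp add: cutoff_def bump_def exp_minus)
qed

section \<open>Gradients and their zeros\<close>

lemma grad_eqI:
  assumes "GDERIV u x :> D" shows "grad u x = D"
  unfolding grad_def
proof (rule the_equality)
  fix E assume "GDERIV u x :> E"
  then have "(\<lambda>h. h \<bullet> E) = (\<lambda>h. h \<bullet> D)"
    using assms unfolding gderiv_def by (rule has_derivative_unique)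
  then have "(E - D) \<bullet> (E - D) = 0" by (metis inner_diff_right right_minus_eq)
  then show "E = D" by simp
qed (fact assms)

lemma Ck_GDERIV:
  assumes "Ck (Suc m) u" shows "GDERIV u x :> (\<Sum>b\<in>Basis. frechet_derivative u (at x) b *\<^sub>R b)"
proof -
  have lin: "linear (frechet_derivative u (at x))"
    using Ck_has_derivative[OF assms] by (rule has_derivative_linear)
  have "frechet_derivative u (at x) h = h \<bullet> (\<Sum>b\<in>Basis. frechet_derivative u (at x) b *\<^sub>R b)" for h
  proof -
    have "frechet_derivative u (at x) h = frechet_derivative u (at x) (\<Sum>b\<in>Basis. (h \<bullet> b) *\<^sub>R b)"
      by (simp add: euclidean_representation)
    also have "\<dots> = (\<Sum>b\<in>Basis. (h \<bullet> b) * frechet_derivative u (at x) b)"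
      by (simp add: linear_sum[OF lin] linear_scale[OF lin])
    finally show ?thesis by (simp add: inner_sum_right mult.commute)
  qed
  then have "frechet_derivative u (at x) = (\<lambda>h. h \<bullet> (\<Sum>b\<in>Basis. frechet_derivative u (at x) b *\<^sub>R b))" ..
  then show ?thesis
    using Ck_has_derivative[OF assms, of x] unfolding gderiv_def by metis
qed

section \<open>Test functions: gradients, supports, bounds and vector space operations\<close>

lemma Cc_infinity_Ck: "u \<in> Cc_infinity \<Longrightarrow> Ck m u"
  by (simp add: Cc_infinity_def)

lemma GDERIV_grad:
  assumes "u \<in> Cc_infinity" shows "GDERIV u x :> grad u x"
proof -
  note G = Ck_GDERIV[OF Cc_infinity_Ck[OF assms], of x]
  show ?thesis unfolding grad_eqI[OF G] by (rule G)
qed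

lemma Cc_infinity_continuous: "u \<in> Cc_infinity \<Longrightarrow> continuous_on UNIV u"
  by (rule Ck_continuous[OF Cc_infinity_Ck])

lemma continuous_grad:
  assumes u: "u \<in> Cc_infinity" shows "continuous_on UNIV (grad u)"
proof -
  have "grad u = (\<lambda>x. \<Sum>b\<in>Basis. frechet_derivative u (at x) b *\<^sub>R b)"
    using grad_eqI[OF Ck_GDERIV[OF Cc_infinity_Ck[OF u]]] by blast
  moreover have "continuous_on UNIV (\<lambda>x. frechet_derivative u (at x) b)" if "b \<in> Basis" for b
    using Ck_continuous[OF Ck_partial[OF Cc_infinity_Ck[OF u] that, of 0]] .
  ultimately show ?thesis by (simp add: continuous_on_sum continuous_on_scaleR)
qed

lemma Cc_infinityI:
  assumes "\<And>m. Ck m u" "\<And>x. R < norm x \<Longrightarrow> u x = 0"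
  shows "u \<in> Cc_infinity"
proof -
  have "{x. u x \<noteq> 0} \<subseteq> cball 0 R" using assms(2) by force
  then have "bounded {x. u x \<noteq> 0}" using bounded_cball bounded_subset by blast
  then show ?thesis using assms(1) by (simp add: Cc_infinity_def compact_closure)
qed

lemma Cc_infinity_support:
  assumes u: "u \<in> Cc_infinity"
  obtains R where "R > 0" "\<And>x. R < norm x \<Longrightarrow> u x = 0" "\<And>x. R < norm x \<Longrightarrow> grad u x = 0"
proof -
  have "bounded {x. u x \<noteq> 0}"
    using u by (simp add: Cc_infinity_def compact_closure)
  then obtain R where R: "R > 0" "\<And>x. u x \<noteq> 0 \<Longrightarrow> norm x \<le> R"
    unfolding bounded_pos by blast
  have "grad u x = 0" if x: "R < norm x" for x
  proof (rule grad_eqI)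
    have "open {x::'a. R < norm x}" by (intro open_Collect_less continuous_intros)
    moreover have "((\<lambda>x. 0) has_derivative (\<lambda>h. h \<bullet> 0)) (at x)" by simp
    moreover have "0 = u y" if "y \<in> {x. R < norm x}" for y using R(2)[of y] that by fastforce
    ultimately show "GDERIV u x :> 0"
      unfolding gderiv_def using x by (metis (no_types, lifting) has_derivative_transform_within_open mem_Collect_eq)
  qed
  moreover have "u x = 0" if "R < norm x" for x using R(2)[of x] that by fastforce
  ultimately show thesis using that R(1) by metis
qed

lemma continuous_bounded_support:
  fixes v :: "'a::euclidean_space \<Rightarrow> 'b::real_normed_vector"
  assumes "continuous_on UNIV v" "\<And>x. R < norm x \<Longrightarrow> v x = 0"
  shows "\<exists>C\<ge>0. \<forall>x. norm (v x) \<le> C"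
proof -
  have "compact (v ` cball 0 R)"
    using assms(1) by (intro compact_continuous_image continuous_on_subset[OF assms(1)]) auto
  then obtain C where C: "C > 0" "\<And>x. x \<in> cball 0 R \<Longrightarrow> norm (v x) \<le> C"
    using compact_imp_bounded[of "v ` cball 0 R"] unfolding bounded_pos by (meson imageI)
  have "norm (v x) \<le> C" for x
    using C assms(2)[of x] by (cases "norm x \<le> R") auto
  then show ?thesis using C(1) by (intro exI[of _ C]) auto
qed

lemma Cc_infinity_bounded:
  assumes u: "u \<in> Cc_infinity" shows "\<exists>C\<ge>0. \<forall>x. \<bar>u x\<bar> \<le> C" "\<exists>C\<ge>0. \<forall>x. norm (grad u x) \<le> C"
proof -
  obtain R where "R > 0" "\<And>x. R < norm x \<Longrightarrow> u x = 0" "\<And>x. R < norm x \<Longrightarrow> grad u x = 0"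
    by (rule Cc_infinity_support[OF u]) (rule that)
  then show "\<exists>C\<ge>0. \<forall>x. \<bar>u x\<bar> \<le> C" "\<exists>C\<ge>0. \<forall>x. norm (grad u x) \<le> C"
    using continuous_bounded_support[OF Cc_infinity_continuous[OF u], of R]
      continuous_bounded_support[OF continuous_grad[OF u], of R] by simp_all
qed

lemma Cc_infinity_add:
  assumes "u \<in> Cc_infinity" "w \<in> Cc_infinity" shows "(\<lambda>x. u x + w x) \<in> Cc_infinity"
proof -
  obtain R where "R > 0" "\<And>x. R < norm x \<Longrightarrow> u x = 0" "\<And>x. R < norm x \<Longrightarrow> grad u x = 0"
    by (rule Cc_infinity_support[OF assms(1)]) (rule that)
  obtain S where "S > 0" "\<And>x. S < norm x \<Longrightarrow> w x = 0" "\<And>x. S < norm x \<Longrightarrow> grad w x = 0"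
    by (rule Cc_infinity_support[OF assms(2)]) (rule that)
  with \<open>\<And>x. R < norm x \<Longrightarrow> u x = 0\<close> show ?thesis
    by (intro Cc_infinityI[where R = "max R S"] Ck_add[OF Cc_infinity_Ck Cc_infinity_Ck] assms) simp
qed

lemma Cc_infinity_mult:
  assumes "u \<in> Cc_infinity" "\<And>m. Ck m w" shows "(\<lambda>x. u x * w x) \<in> Cc_infinity"
proof -
  obtain R where "R > 0" "\<And>x. R < norm x \<Longrightarrow> u x = 0" "\<And>x. R < norm x \<Longrightarrow> grad u x = 0"
    by (rule Cc_infinity_support[OF assms(1)]) (rule that)
  then show ?thesis
    by (intro Cc_infinityI[where R = R] Ck_mult[OF Cc_infinity_Ck] assms) simp
qed

lemma Cc_infinity_scale: "u \<in> Cc_infinity \<Longrightarrow> (\<lambda>x. c * u x) \<in> Cc_infinity"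
  using Cc_infinity_mult[of u "\<lambda>_. c", OF _ Ck_const] by (simp add: mult.commute)

lemma Cc_infinity_0: "(\<lambda>x. 0) \<in> Cc_infinity"
  by (rule Cc_infinityI[OF Ck_const]) simp

lemma grad_add:
  "u \<in> Cc_infinity \<Longrightarrow> w \<in> Cc_infinity \<Longrightarrow> grad (\<lambda>x. u x + w x) x = grad u x + grad w x"
  by (rule grad_eqI[OF GDERIV_add[OF GDERIV_grad GDERIV_grad]])

lemma grad_scale:
  assumes "u \<in> Cc_infinity" shows "grad (\<lambda>x. c * u x) x = c *\<^sub>R grad u x"
  by (rule grad_eqI, rule GDERIV_subst[OF GDERIV_mult[OF GDERIV_const GDERIV_grad[OF assms]]]) simp

text \<open>On \<open>A\<close> the derivative in direction \<open>b\<close> is bounded away from \<open>0\<close>, so \<open>u\<close> has no further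
  zeros nearby in that direction: infinitely many small translates of \<open>A\<close> along \<open>b\<close> are disjoint.\<close>

lemma null_zeros_with_derivative:
  assumes u: "u \<in> Cc_infinity" and b: "b \<in> Basis" and e: "0 < e"
  shows "negligible {x. u x = 0 \<and> e \<le> \<bar>grad u x \<bullet> b\<bar>}" (is "negligible ?A")
proof -
  obtain R where R: "R > 0" "\<And>x. R < norm x \<Longrightarrow> u x = 0" "\<And>x. R < norm x \<Longrightarrow> grad u x = 0"
    by (rule Cc_infinity_support[OF u]) (rule that)
  define v where "v x = grad u x \<bullet> b" for x
  have contv: "continuous_on UNIV v"
    unfolding v_def by (intro continuous_on_inner continuous_grad[OF u] continuous_on_const)
  have A_sub: "?A \<subseteq> cball 0 R"
  proof
    fix x assume "x \<in> ?A"
    then show "x \<in> cball 0 R" using R(3)[of x] e by (cases "R < norm x") auto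
  qed
  have "closed {x. u x = 0}"
    by (rule closed_Collect_eq[OF Cc_infinity_continuous[OF u] continuous_on_const])
  moreover have "closed {x. e \<le> \<bar>v x\<bar>}"
    by (rule closed_Collect_le[OF continuous_on_const continuous_on_rabs[OF contv]])
  ultimately have "closed ?A" unfolding v_def by (rule closed_Collect_conj)
  then have cA: "compact ?A"
    using A_sub by (meson bounded_cball bounded_subset compact_eq_bounded_closed)
  then have mA: "?A \<in> lmeasurable" by (rule lmeasurable_compact)
  have "uniformly_continuous_on (cball 0 (R + 1)) v"
    using contv by (intro compact_uniformly_continuous) (auto intro: continuous_on_subset)
  then obtain d where d: "d > 0" "\<And>x y. x \<in> cball 0 (R + 1) \<Longrightarrow> y \<in> cball 0 (R + 1) \<Longrightarrow> dist y x < d \<Longrightarrow> dist (v y) (v x) < e"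
    using e unfolding uniformly_continuous_on_def by meson
  define r where "r = min d 1"
  have r: "0 < r" "r \<le> d" "r \<le> 1" using d by (auto simp: r_def)
  \<comment> \<open>By the mean value theorem, two points of the set on a segment in direction
    \<open>b\<close> have a zero of \<open>v\<close> between them. But \<open>v\<close> has size at
    least \<open>e\<close> at \<open>x\<close> and changes by less than \<open>e\<close> within
    distance \<open>r\<close>.\<close>
  have no_zero: "x + t *\<^sub>R b \<notin> ?A" if x: "x \<in> ?A" and t: "0 < t" "t < r" for x t
  proof
    assume y: "x + t *\<^sub>R b \<in> ?A"
    have "((\<lambda>s. u (x + s *\<^sub>R b)) has_real_derivative v (x + s *\<^sub>R b)) (at s)" for s
    proof -
      have "((\<lambda>s. x + s *\<^sub>R b) has_derivative (\<lambda>h. h *\<^sub>R b)) (at s)"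
        by (auto intro!: derivative_eq_intros)
      from has_derivative_compose[OF this GDERIV_grad[OF u, unfolded gderiv_def]]
      show ?thesis unfolding has_field_derivative_def
        by (rule has_derivative_eq_rhs) (simp add: fun_eq_iff v_def inner_commute)
    qed
    from MVT2[OF t(1) this] obtain s where s: "0 < s" "s < t" "u (x + t *\<^sub>R b) - u x = t * v (x + s *\<^sub>R b)"
      by auto
    then have v0: "v (x + s *\<^sub>R b) = 0" using x y t by simp
    have "norm x \<le> R" using x A_sub by auto
    moreover have "norm (x + s *\<^sub>R b) \<le> norm x + s"
      using norm_triangle_ineq[of x "s *\<^sub>R b"] s b by simp
    moreover have "norm (x + s *\<^sub>R b) \<le> R + 1" using calculation s t r by simp
    ultimately have "dist (v (x + s *\<^sub>R b)) (v x) < e"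
      using s t r b by (intro d(2)) (simp_all add: mem_cball_0 del: mem_cball, simp_all add: dist_norm)
    then show False using v0 x by (simp add: v_def dist_norm)
  qed
  \<comment> \<open>Infinitely many distinct shifts in the interval from \<open>0\<close> to
    \<open>r\<close>. Their differences are shorter than \<open>r\<close> too, so
    \<open>no_zero\<close> separates the translates.\<close>
  define t where "t i = r / (real i + 2)" for i
  have t_bounds: "0 < t i" "t i < r" for i
    using r by (simp_all add: t_def field_simps add_pos_nonneg)
  have disj: "disjnt ((+) (t i *\<^sub>R b) ` ?A) ((+) (t j *\<^sub>R b) ` ?A)" if ij: "i < j" for i j
  proof -
    have t: "0 < t i - t j" "t i - t j < r"
    proof -
      have "t j < t i" using ij r by (simp add: t_def frac_less2)
      then show "0 < t i - t j" "t i - t j < r" using t_bounds[of i] t_bounds[of j] by auto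
    qed
    show ?thesis
      unfolding disjnt_iff
    proof (intro allI notI, elim conjE imageE)
      fix z x y assume "x \<in> ?A" "y \<in> ?A" "z = t i *\<^sub>R b + x" "z = t j *\<^sub>R b + y"
      moreover from this have "y = x + (t i - t j) *\<^sub>R b" by (simp add: algebra_simps)
      ultimately show False using no_zero[OF \<open>x \<in> ?A\<close> t] by simp
    qed
  qed
  \<comment> \<open>For every \<open>n\<close>, one fixed ball contains \<open>n\<close> disjoint
    translates of equal measure.\<close>
  have bound: "real n * measure lebesgue ?A \<le> measure lebesgue (cball (0::'a) (R + 1))" for n
  proof -
    have m: "(+) c ` ?A \<in> lmeasurable" for c
      using mA by (rule measurable_translation)
    have "pairwise (\<lambda>i j. disjnt ((+) (t i *\<^sub>R b) ` ?A) ((+) (t j *\<^sub>R b) ` ?A)) {..<n}"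
    proof (rule pairwiseI)
      fix i j :: nat assume "i \<noteq> j"
      then consider "i < j" | "j < i" by linarith
      then show "disjnt ((+) (t i *\<^sub>R b) ` ?A) ((+) (t j *\<^sub>R b) ` ?A)"
        by cases (rule disj, assumption, rule disjnt_sym, rule disj, assumption)
    qed
    then have "measure lebesgue (\<Union>i<n. (+) (t i *\<^sub>R b) ` ?A) = (\<Sum>i<n. measure lebesgue ((+) (t i *\<^sub>R b) ` ?A))"
      by (intro measure_UNION') (auto intro: m)
    also have "\<dots> = real n * measure lebesgue ?A"
      by (simp add: measure_translation)
    finally have "real n * measure lebesgue ?A = measure lebesgue (\<Union>i<n. (+) (t i *\<^sub>R b) ` ?A)" ..
    also have "\<dots> \<le> measure lebesgue (cball (0::'a) (R + 1))"
    proof (rule measure_mono_fmeasurable)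
      show "(\<Union>i<n. (+) (t i *\<^sub>R b) ` ?A) \<subseteq> cball 0 (R + 1)"
      proof
        fix z assume "z \<in> (\<Union>i<n. (+) (t i *\<^sub>R b) ` ?A)"
        then obtain i x where z: "x \<in> ?A" "z = t i *\<^sub>R b + x" by blast
        have "\<bar>t i\<bar> \<le> 1" using r t_bounds[of i] by simp
        moreover have "norm z \<le> \<bar>t i\<bar> + norm x"
          using norm_triangle_ineq[of "t i *\<^sub>R b" x] b z(2) by simp
        moreover have "norm x \<le> R" using z(1) A_sub by auto
        ultimately show "z \<in> cball 0 (R + 1)" by simp
      qed
      show "(\<Union>i<n. (+) (t i *\<^sub>R b) ` ?A) \<in> sets lebesgue"
        using m by (intro sets.finite_UN) (auto simp: fmeasurable_def)
    qed auto
    finally show ?thesis .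
  qed
  have "measure lebesgue ?A = 0"
  proof (rule ccontr)
    assume "measure lebesgue ?A \<noteq> 0"
    then have "0 < measure lebesgue ?A" using zero_less_measure_iff by blast
    then obtain n where "measure lebesgue (cball (0::'a) (R + 1)) < real n * measure lebesgue ?A"
      using reals_Archimedean3 by blast
    then show False using bound[of n] by simp
  qed
  then show ?thesis using mA by (simp add: negligible_iff_measure0)
qed

text \<open>A nonzero gradient has a component of size at least \<open>1 / Suc n\<close> for some
  \<open>n\<close>, so countably many null sets cover the exceptional set. Applied to the difference
  of two representatives, this makes the gradient a function of the class.\<close>

lemma grad_eq_0_AE_on_zeros:
  assumes u: "u \<in> Cc_infinity"
  shows "AE x in lebesgue. u x = 0 \<longrightarrow> grad u x = 0"
proof -
  let ?A = "\<lambda>b n. {x. u x = 0 \<and> 1 / real (Suc n) \<le> \<bar>grad u x \<bullet> b\<bar>}"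
  have "negligible (\<Union>n. ?A b n)" if "b \<in> Basis" for b
    by (intro negligible_Union_nat null_zeros_with_derivative[OF u that]) simp
  then have "negligible (\<Union>b\<in>Basis. \<Union>n. ?A b n)"
    by (intro negligible_Union) auto
  moreover have "{x. u x = 0 \<and> grad u x \<noteq> 0} \<subseteq> (\<Union>b\<in>Basis. \<Union>n. ?A b n)"
  proof clarsimp
    fix x assume "u x = 0" "grad u x \<noteq> 0"
    then obtain b where b: "b \<in> Basis" "grad u x \<bullet> b \<noteq> 0"
      using euclidean_all_zero_iff by blast
    then obtain n where "inverse (real (Suc n)) < \<bar>grad u x \<bullet> b\<bar>"
      using reals_Archimedean[of "\<bar>grad u x \<bullet> b\<bar>"] by auto
    with b show "\<exists>b\<in>Basis. \<exists>n. 1 / (1 + real n) \<le> \<bar>grad u x \<bullet> b\<bar>"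
      by (auto simp: inverse_eq_divide intro!: bexI[of _ b] exI[of _ n])
  qed
  ultimately have "negligible {x. u x = 0 \<and> grad u x \<noteq> 0}" by (rule negligible_subset)
  then have "{x. u x = 0 \<and> grad u x \<noteq> 0} \<in> null_sets lebesgue" by (simp add: negligible_iff_null_sets)
  then show ?thesis by (rule AE_I') auto
qed

section \<open>Mass and energy forms of a weight\<close>

lemma restrict_pos_eq_iff:
  "restrict_pos \<rho> u = restrict_pos \<rho> w \<longleftrightarrow> (AE x in lebesgue. 0 < \<rho> x \<longrightarrow> u x = w x)"
proof -
  have "(u x * indicator {x. 0 < \<rho> x} x = w x * indicator {x. 0 < \<rho> x} x) \<longleftrightarrow> (0 < \<rho> x \<longrightarrow> u x = w x)" for x
    by (simp add: indicator_def)
  then show ?thesis unfolding restrict_pos_def aefun.abs_eq_iff by simp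
qed

lemma restrict_pos_add: "restrict_pos \<rho> u + restrict_pos \<rho> w = restrict_pos \<rho> (\<lambda>x. u x + w x)"
  by (simp add: restrict_pos_def plus_aefun.abs_eq distrib_right)

lemma restrict_pos_scale: "c *\<^sub>R restrict_pos \<rho> u = restrict_pos \<rho> (\<lambda>x. c * u x)"
  by (simp add: restrict_pos_def scaleR_aefun.abs_eq mult.assoc)

lemma restrict_pos_0: "restrict_pos \<rho> (\<lambda>x. 0) = 0"
  by (simp add: restrict_pos_def zero_aefun_def)

lemma restrict_pos_mem: "u \<in> Cc_infinity \<Longrightarrow> restrict_pos \<rho> u \<in> restricted_space \<rho>"
  by (simp add: restricted_space_def)

lemma restricted_spaceE:
  assumes "f \<in> restricted_space \<rho>"
  obtains u where "u \<in> Cc_infinity" "f = restrict_pos \<rho> u"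
  using assms unfolding restricted_space_def by (rule imageE) (rule that)

lemma subspace_restricted_space: "subspace (restricted_space \<rho>)"
  unfolding subspace_def
proof (intro conjI ballI allI)
  show "0 \<in> restricted_space \<rho>"
    using restrict_pos_mem[OF Cc_infinity_0, of \<rho>] by (simp add: restrict_pos_0)
next
  fix f g assume "f \<in> restricted_space \<rho>" "g \<in> restricted_space \<rho>"
  then show "f + g \<in> restricted_space \<rho>"
    by (elim restricted_spaceE) (simp add: restrict_pos_add restrict_pos_mem Cc_infinity_add)
next
  fix c f assume "f \<in> restricted_space \<rho>"
  then show "c *\<^sub>R f \<in> restricted_space \<rho>"
    by (elim restricted_spaceE) (simp add: restrict_pos_scale restrict_pos_mem Cc_infinity_scale)
qed

section \<open>Integrals against a weight\<close>

lemma continuous_imp_lebesgue_measurable: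
  fixes f :: "'a::euclidean_space \<Rightarrow> 'b::{second_countable_topology,topological_space}"
  shows "continuous_on UNIV f \<Longrightarrow> f \<in> borel_measurable lebesgue"
  by (intro measurable_completion) (simp add: borel_measurable_continuous_onI)

text \<open>\<open>K\<close> will be the essential supremum of the weight. As a plain real upper
  bound it keeps the extended reals out of the estimates on \<open>\<rho>\<close>.\<close>

locale weight =
  fixes \<rho> :: "'a::euclidean_space \<Rightarrow> real" and K :: real
  assumes integrable_weight: "integrable lebesgue \<rho>"
    and weight_nonneg: "AE x in lebesgue. 0 \<le> \<rho> x"
    and weight_le: "AE x in lebesgue. \<rho> x \<le> K"
begin

lemma weight_measurable [measurable]: "\<rho> \<in> borel_measurable lebesgue"
  using integrable_weight by (rule borel_measurable_integrable)

lemma integrable_weight_mult: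
  assumes "f \<in> borel_measurable lebesgue" "\<And>x. \<bar>f x\<bar> \<le> C"
  shows "integrable lebesgue (\<lambda>x. \<rho> x * f x)"
proof (rule Bochner_Integration.integrable_bound)
  show "integrable lebesgue (\<lambda>x. C * \<bar>\<rho> x\<bar>)" using integrable_weight by simp
  show "(\<lambda>x. \<rho> x * f x) \<in> borel_measurable lebesgue" using assms(1) by measurable
  have "0 \<le> C" using assms(2)[of undefined] by linarith
  then have "\<bar>\<rho> x * f x\<bar> \<le> \<bar>C * \<bar>\<rho> x\<bar>\<bar>" for x
  proof -
    have "\<bar>\<rho> x\<bar> * \<bar>f x\<bar> \<le> \<bar>\<rho> x\<bar> * C" using assms(2) by (intro mult_left_mono) auto
    then show ?thesis using \<open>0 \<le> C\<close> by (simp add: abs_mult mult.commute)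
  qed
  then show "AE x in lebesgue. norm (\<rho> x * f x) \<le> norm (C * \<bar>\<rho> x\<bar>)" by simp
qed

lemma integrable_mass:
  assumes "u \<in> Cc_infinity" "w \<in> Cc_infinity"
  shows "integrable lebesgue (\<lambda>x. \<rho> x * (u x * w x))"
proof -
  obtain C D where C: "0 \<le> C" "\<And>x. \<bar>u x\<bar> \<le> C" and D: "\<And>x. \<bar>w x\<bar> \<le> D"
    using Cc_infinity_bounded(1)[OF assms(1)] Cc_infinity_bounded(1)[OF assms(2)] by meson
  show ?thesis
  proof (rule integrable_weight_mult)
    show "(\<lambda>x. u x * w x) \<in> borel_measurable lebesgue"
      by (intro continuous_imp_lebesgue_measurable continuous_on_mult Cc_infinity_continuous assms)
    show "\<bar>u x * w x\<bar> \<le> C * D" for x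
      unfolding abs_mult using C D by (intro mult_mono) auto
  qed
qed

lemma integrable_energy:
  assumes "u \<in> Cc_infinity" "w \<in> Cc_infinity"
  shows "integrable lebesgue (\<lambda>x. \<rho> x * (grad u x \<bullet> grad w x))"
proof -
  obtain C D where C: "0 \<le> C" "\<And>x. norm (grad u x) \<le> C" and D: "\<And>x. norm (grad w x) \<le> D"
    using Cc_infinity_bounded(2)[OF assms(1)] Cc_infinity_bounded(2)[OF assms(2)] by meson
  show ?thesis
  proof (rule integrable_weight_mult)
    show "(\<lambda>x. grad u x \<bullet> grad w x) \<in> borel_measurable lebesgue"
      by (intro continuous_imp_lebesgue_measurable continuous_on_inner continuous_grad assms)
    have "norm (grad u x) * norm (grad w x) \<le> C * D" for x
      using C D by (intro mult_mono) auto
    then show "\<bar>grad u x \<bullet> grad w x\<bar> \<le> C * D" for x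
      using Cauchy_Schwarz_ineq2[of "grad u x" "grad w x"] order_trans by blast
  qed
qed

text \<open>A class has no canonical smooth representative, so one is chosen. Outside
  \<open>restricted_space \<rho>\<close> the choice is arbitrary, which is why
  \<open>form_on\<close> asks for its laws on a subspace only.\<close>

definition lift :: "'a aefun \<Rightarrow> 'a \<Rightarrow> real" where
  "lift f = (SOME u. u \<in> Cc_infinity \<and> restrict_pos \<rho> u = f)"

definition mass :: "'a aefun \<Rightarrow> 'a aefun \<Rightarrow> real" where
  "mass f g = (\<integral>x. \<rho> x * (lift f x * lift g x) \<partial>lebesgue)"

definition energy :: "'a aefun \<Rightarrow> 'a aefun \<Rightarrow> real" where
  "energy f g = (\<integral>x. \<rho> x * (grad (lift f) x \<bullet> grad (lift g) x) \<partial>lebesgue)"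

text \<open>The chosen representative and \<open>u\<close> differ by a test function that vanishes
  almost everywhere where \<open>\<rho>\<close> is positive; there its gradient vanishes almost
  everywhere too. Hence mass and energy can be computed from any representative.\<close>

lemma lift_restrict_pos:
  assumes u: "u \<in> Cc_infinity"
  shows "lift (restrict_pos \<rho> u) \<in> Cc_infinity"
    and "AE x in lebesgue. 0 < \<rho> x \<longrightarrow> lift (restrict_pos \<rho> u) x = u x"
    and "AE x in lebesgue. 0 < \<rho> x \<longrightarrow> grad (lift (restrict_pos \<rho> u)) x = grad u x"
proof -
  define w where "w = lift (restrict_pos \<rho> u)"
  have "w \<in> Cc_infinity \<and> restrict_pos \<rho> w = restrict_pos \<rho> u"
    unfolding w_def lift_def by (rule someI[of _ u]) (simp add: u)
  then have w: "w \<in> Cc_infinity" "AE x in lebesgue. 0 < \<rho> x \<longrightarrow> w x = u x"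
    by (simp_all add: restrict_pos_eq_iff)
  have d: "(\<lambda>x. w x + -1 * u x) \<in> Cc_infinity"
    by (intro Cc_infinity_add Cc_infinity_scale w(1) u)
  have "grad (\<lambda>x. w x + -1 * u x) x = grad w x - grad u x" for x
    using grad_add[OF w(1) Cc_infinity_scale[OF u, of "-1"]] grad_scale[OF u, of "-1"] by simp
  then have "AE x in lebesgue. w x = u x \<longrightarrow> grad w x = grad u x"
    using grad_eq_0_AE_on_zeros[OF d] by simp
  with w(2) have "AE x in lebesgue. 0 < \<rho> x \<longrightarrow> grad w x = grad u x"
    by eventually_elim simp
  with w show "lift (restrict_pos \<rho> u) \<in> Cc_infinity"
    "AE x in lebesgue. 0 < \<rho> x \<longrightarrow> lift (restrict_pos \<rho> u) x = u x"
    "AE x in lebesgue. 0 < \<rho> x \<longrightarrow> grad (lift (restrict_pos \<rho> u)) x = grad u x"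
    by (simp_all add: w_def)
qed

lemma mass_restrict_pos:
  assumes u: "u \<in> Cc_infinity" and w: "w \<in> Cc_infinity"
  shows "mass (restrict_pos \<rho> u) (restrict_pos \<rho> w) = (\<integral>x. \<rho> x * (u x * w x) \<partial>lebesgue)"
  unfolding mass_def
proof (rule integral_cong_AE)
  \<comment> \<open>Where \<open>\<rho> x = 0\<close> both integrands vanish; where it is positive
    the representatives agree almost everywhere.\<close>
  show "AE x in lebesgue. \<rho> x * (lift (restrict_pos \<rho> u) x * lift (restrict_pos \<rho> w) x) = \<rho> x * (u x * w x)"
    using weight_nonneg lift_restrict_pos(2)[OF u] lift_restrict_pos(2)[OF w]
    by eventually_elim (auto simp: order_le_less)
qed (intro borel_measurable_integrable integrable_mass lift_restrict_pos(1) u w)+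

lemma energy_restrict_pos:
  assumes u: "u \<in> Cc_infinity" and w: "w \<in> Cc_infinity"
  shows "energy (restrict_pos \<rho> u) (restrict_pos \<rho> w) = (\<integral>x. \<rho> x * (grad u x \<bullet> grad w x) \<partial>lebesgue)"
  unfolding energy_def
proof (rule integral_cong_AE)
  show "AE x in lebesgue. \<rho> x * (grad (lift (restrict_pos \<rho> u)) x \<bullet> grad (lift (restrict_pos \<rho> w)) x)
      = \<rho> x * (grad u x \<bullet> grad w x)"
    using weight_nonneg lift_restrict_pos(3)[OF u] lift_restrict_pos(3)[OF w]
    by eventually_elim (auto simp: order_le_less)
qed (intro borel_measurable_integrable integrable_energy lift_restrict_pos(1) u w)+

lemma form_on_mass: "form_on (restricted_space \<rho>) mass"
proof
  fix f g assume "f \<in> restricted_space \<rho>" "g \<in> restricted_space \<rho>"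
  then show "mass f g = mass g f" by (simp add: mass_def mult.commute)
next
  fix f g h assume "f \<in> restricted_space \<rho>" "g \<in> restricted_space \<rho>" "h \<in> restricted_space \<rho>"
  then show "mass (f + g) h = mass f h + mass g h"
  proof (elim restricted_spaceE)
    fix u v w assume [simp]: "f = restrict_pos \<rho> u" "g = restrict_pos \<rho> v" "h = restrict_pos \<rho> w"
      and c: "u \<in> Cc_infinity" "v \<in> Cc_infinity" "w \<in> Cc_infinity"
    have "mass (f + g) h = (\<integral>x. \<rho> x * (u x * w x) + \<rho> x * (v x * w x) \<partial>lebesgue)"
      using c by (simp add: restrict_pos_add mass_restrict_pos Cc_infinity_add algebra_simps)
    then show ?thesis using c by (simp add: mass_restrict_pos integrable_mass)
  qed
next
  fix c f h assume "f \<in> restricted_space \<rho>" "h \<in> restricted_space \<rho>"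
  then show "mass (c *\<^sub>R f) h = c * mass f h"
  proof (elim restricted_spaceE)
    fix u w assume [simp]: "f = restrict_pos \<rho> u" "h = restrict_pos \<rho> w"
      and u: "u \<in> Cc_infinity" "w \<in> Cc_infinity"
    have "mass (c *\<^sub>R f) h = (\<integral>x. c * (\<rho> x * (u x * w x)) \<partial>lebesgue)"
      using u by (simp add: restrict_pos_scale mass_restrict_pos Cc_infinity_scale algebra_simps)
    then show ?thesis using u by (simp add: mass_restrict_pos)
  qed
qed (rule subspace_restricted_space)

lemma form_on_energy: "form_on (restricted_space \<rho>) energy"
proof
  fix f g assume "f \<in> restricted_space \<rho>" "g \<in> restricted_space \<rho>"
  then show "energy f g = energy g f" by (simp add: energy_def inner_commute)
next
  fix f g h assume "f \<in> restricted_space \<rho>" "g \<in> restricted_space \<rho>" "h \<in> restricted_space \<rho>"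
  then show "energy (f + g) h = energy f h + energy g h"
  proof (elim restricted_spaceE)
    fix u v w assume [simp]: "f = restrict_pos \<rho> u" "g = restrict_pos \<rho> v" "h = restrict_pos \<rho> w"
      and c: "u \<in> Cc_infinity" "v \<in> Cc_infinity" "w \<in> Cc_infinity"
    have "energy (f + g) h = (\<integral>x. \<rho> x * (grad u x \<bullet> grad w x) + \<rho> x * (grad v x \<bullet> grad w x) \<partial>lebesgue)"
      using c by (simp add: restrict_pos_add energy_restrict_pos Cc_infinity_add grad_add inner_add_left distrib_left)
    then show ?thesis using c by (simp add: energy_restrict_pos integrable_energy)
  qed
next
  fix c f h assume "f \<in> restricted_space \<rho>" "h \<in> restricted_space \<rho>"
  then show "energy (c *\<^sub>R f) h = c * energy f h"
  proof (elim restricted_spaceE)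
    fix u w assume [simp]: "f = restrict_pos \<rho> u" "h = restrict_pos \<rho> w"
      and u: "u \<in> Cc_infinity" "w \<in> Cc_infinity"
    have "energy (c *\<^sub>R f) h = (\<integral>x. c * (\<rho> x * (grad u x \<bullet> grad w x)) \<partial>lebesgue)"
      using u by (simp add: restrict_pos_scale energy_restrict_pos Cc_infinity_scale grad_scale mult.left_commute)
    then show ?thesis using u by (simp add: energy_restrict_pos)
  qed
qed (rule subspace_restricted_space)

lemma energy_nonneg: "f \<in> restricted_space \<rho> \<Longrightarrow> 0 \<le> energy f f"
  unfolding energy_def using weight_nonneg by (intro integral_nonneg_AE) (auto elim: eventually_mono)

text \<open>Definiteness is owed to the quotient: zero mass forces \<open>u = 0\<close> almost
  everywhere where \<open>\<rho>\<close> is positive, and that is the zero class.\<close>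

lemma mass_pos:
  assumes f: "f \<in> restricted_space \<rho>" "f \<noteq> 0"
  shows "0 < mass f f"
proof -
  obtain u where u: "u \<in> Cc_infinity" and fu: "f = restrict_pos \<rho> u"
    using f(1) by (rule restricted_spaceE)
  have eq: "mass f f = (\<integral>x. \<rho> x * (u x * u x) \<partial>lebesgue)"
    unfolding fu by (rule mass_restrict_pos[OF u u])
  have nn: "AE x in lebesgue. 0 \<le> \<rho> x * (u x * u x)"
    using weight_nonneg by eventually_elim simp
  have "mass f f \<noteq> 0"
  proof
    assume "mass f f = 0"
    then have "AE x in lebesgue. \<rho> x * (u x * u x) = 0"
      unfolding eq using integral_nonneg_eq_0_iff_AE[OF integrable_mass[OF u u] nn] by simp
    then have "AE x in lebesgue. 0 < \<rho> x \<longrightarrow> u x = 0"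
      by eventually_elim auto
    then have "restrict_pos \<rho> u = restrict_pos \<rho> (\<lambda>x. 0)"
      by (simp add: restrict_pos_eq_iff)
    then show False using f(2) by (simp add: fu restrict_pos_0)
  qed
  moreover have "0 \<le> mass f f" unfolding eq using nn by (rule integral_nonneg_AE)
  ultimately show ?thesis by simp
qed

lemma rayleigh_eq:
  assumes "u \<in> Cc_infinity"
  shows "rayleigh \<rho> u = energy (restrict_pos \<rho> u) (restrict_pos \<rho> u) / mass (restrict_pos \<rho> u) (restrict_pos \<rho> u)"
  unfolding rayleigh_def energy_restrict_pos[OF assms assms] mass_restrict_pos[OF assms assms]
  by (simp add: power2_norm_eq_inner flip: power2_eq_square)

text \<open>\<open>M < mu k \<rho>\<close> gives every admissible subspace of dimension
  \<open>k + 1\<close> a function with Rayleigh quotient above \<open>M\<close>, which is hypothesis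
  \<open>H\<close> of \<open>form_lower_bound\<close>. Working in \<open>span G\<close> yields one
  family \<Phi> for all of \<open>G\<close>.\<close>

lemma spectral_lower_bound:
  assumes M: "ereal M < mu k \<rho>" and fin: "finite G" "G \<subseteq> restricted_space \<rho>"
  shows "\<exists>\<Phi>. finite \<Phi> \<and> \<Phi> \<subseteq> restricted_space \<rho> \<and> card \<Phi> \<le> k \<and> (\<forall>\<phi>\<in>\<Phi>. mass \<phi> \<phi> = 1) \<and>
    (\<forall>f\<in>G. M * (mass f f - (\<Sum>\<phi>\<in>\<Phi>. (mass f \<phi>)\<^sup>2)) \<le> energy f f)"
proof -
  let ?V = "span G"
  have V: "?V \<subseteq> restricted_space \<rho>"
    using fin(2) subspace_restricted_space by (rule span_minimal)
  have "\<exists>\<Phi>. finite \<Phi> \<and> \<Phi> \<subseteq> ?V \<and> card \<Phi> \<le> k \<and> (\<forall>\<phi>\<in>\<Phi>. mass \<phi> \<phi> = 1) \<and>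
    (\<forall>f\<in>?V. M * (mass f f - (\<Sum>\<phi>\<in>\<Phi>. (mass f \<phi>)\<^sup>2)) \<le> energy f f)"
  proof (rule form_lower_bound[where V = ?V and A = energy and B = mass and G = G])
    show "form_on ?V energy" "form_on ?V mass"
      by (rule form_on_mono[OF form_on_energy subspace_span V],
          rule form_on_mono[OF form_on_mass subspace_span V])
    show "?V \<subseteq> span G" "finite G" using fin by simp_all
    show "0 < mass v v" if "v \<in> ?V" "v \<noteq> 0" for v using mass_pos that V by blast
    show "0 \<le> energy v v" if "v \<in> ?V" for v using energy_nonneg that V by blast
    fix S assume S: "subspace S" "S \<subseteq> ?V" "dim S = k + 1"
    then have "S \<in> subspaces_of_dim \<rho> (k + 1)" using V by (auto simp: subspaces_of_dim_def)
    then have "mu k \<rho> \<le> (SUP u \<in> {u \<in> Cc_infinity. restrict_pos \<rho> u \<in> S - {0}}. ereal (rayleigh \<rho> u))"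
      unfolding mu_def by (rule INF_lower)
    with M have "ereal M < (SUP u \<in> {u \<in> Cc_infinity. restrict_pos \<rho> u \<in> S - {0}}. ereal (rayleigh \<rho> u))"
      by (rule less_le_trans)
    then obtain u where u: "u \<in> Cc_infinity" "restrict_pos \<rho> u \<in> S" "restrict_pos \<rho> u \<noteq> 0" "M < rayleigh \<rho> u"
      unfolding less_SUP_iff by auto
    have "0 < mass (restrict_pos \<rho> u) (restrict_pos \<rho> u)"
      using u by (intro mass_pos restrict_pos_mem)
    then have "M * mass (restrict_pos \<rho> u) (restrict_pos \<rho> u) < energy (restrict_pos \<rho> u) (restrict_pos \<rho> u)"
      using u(4) by (simp add: rayleigh_eq[OF u(1)] pos_less_divide_eq)
    then show "\<exists>u\<in>S. M * mass u u < energy u u" using u(2) by blast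
  qed
  then obtain \<Phi> where "finite \<Phi>" "\<Phi> \<subseteq> ?V" "card \<Phi> \<le> k" "\<forall>\<phi>\<in>\<Phi>. mass \<phi> \<phi> = 1"
    "\<forall>f\<in>?V. M * (mass f f - (\<Sum>\<phi>\<in>\<Phi>. (mass f \<phi>)\<^sup>2)) \<le> energy f f" by blast
  then show ?thesis using V span_superset[of G] by (intro exI[of _ \<Phi>]) blast
qed

end

section \<open>Bessel's inequality on a box\<close>

text \<open>The squared distance from \<open>g\<close> to its projection \<open>P\<close> is
  nonnegative. The \<open>e i\<close> are complex because the modulus of one coefficient against a
  wave then collects both its cosine and its sine integral.\<close>

lemma bessel_inequality:
  fixes g :: "'a \<Rightarrow> real" and e :: "'i \<Rightarrow> 'a \<Rightarrow> complex"
  assumes I: "finite I" and V: "0 < V"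
    and g2: "integrable M (\<lambda>x. (g x)\<^sup>2)"
    and ge: "\<And>i. i \<in> I \<Longrightarrow> integrable M (\<lambda>x. of_real (g x) * e i x)"
    and orth: "\<And>i j. \<lbrakk>i \<in> I; j \<in> I\<rbrakk> \<Longrightarrow>
      has_bochner_integral M (\<lambda>x. e i x * cnj (e j x)) (if i = j then of_real V else 0)"
  shows "(\<Sum>i\<in>I. (cmod (\<integral>x. of_real (g x) * e i x \<partial>M))\<^sup>2) \<le> V * (\<integral>x. (g x)\<^sup>2 \<partial>M)"
proof -
  define a where "a i = (\<integral>x. of_real (g x) * e i x \<partial>M)" for i
  define S where "S = (\<Sum>i\<in>I. (cmod (a i))\<^sup>2)"
  \<comment> \<open>The Fourier coefficient of the real function \<open>g\<close> is its integral
    against \<open>cnj (e i)\<close>, which is the conjugate of \<open>a i\<close>. Division by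
    \<open>V\<close> accounts for the norm of \<open>e i\<close>.\<close>
  define c where "c i = cnj (a i) / of_real V" for i
  define P where "P x = (\<Sum>i\<in>I. c i * e i x)" for x
  have S: "(\<Sum>i\<in>I. a i * cnj (a i)) = of_real S" "(\<Sum>i\<in>I. cnj (a i) * a i) = of_real S"
    by (simp_all add: S_def complex_norm_square[symmetric] mult.commute)
  have hg: "has_bochner_integral M (\<lambda>x. of_real (g x) * of_real (g x)) (complex_of_real (\<integral>x. (g x)\<^sup>2 \<partial>M))"
    using has_bochner_integral_of_real[OF has_bochner_integral_integrable[OF g2]]
    by (simp add: power2_eq_square)
  have he: "has_bochner_integral M (\<lambda>x. of_real (g x) * e i x) (a i)" if "i \<in> I" for i
    unfolding a_def using ge[OF that] by (rule has_bochner_integral_integrable)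
  have "has_bochner_integral M (\<lambda>x. \<Sum>i\<in>I. c i * (of_real (g x) * e i x)) (\<Sum>i\<in>I. c i * a i)"
    by (intro has_bochner_integral_sum has_bochner_integral_mult_right he)
  moreover have "(\<Sum>i\<in>I. c i * a i) = of_real (S / V)"
    using S(2) by (simp add: c_def flip: sum_divide_distrib)
  moreover have "(\<lambda>x. \<Sum>i\<in>I. c i * (of_real (g x) * e i x)) = (\<lambda>x. of_real (g x) * P x)"
    by (simp add: P_def sum_distrib_left mult_ac)
  ultimately have hP: "has_bochner_integral M (\<lambda>x. of_real (g x) * P x) (of_real (S / V))"
    by simp
  from has_bochner_integral_bounded_linear[OF bounded_linear_cnj this]
  have hcP: "has_bochner_integral M (\<lambda>x. of_real (g x) * cnj (P x)) (of_real (S / V))"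
    by simp
  have "has_bochner_integral M (\<lambda>x. \<Sum>i\<in>I. \<Sum>j\<in>I. (c i * cnj (c j)) * (e i x * cnj (e j x)))
      (\<Sum>i\<in>I. \<Sum>j\<in>I. (c i * cnj (c j)) * (if i = j then of_real V else 0))"
    by (intro has_bochner_integral_sum has_bochner_integral_mult_right orth)
  moreover have "(\<Sum>i\<in>I. \<Sum>j\<in>I. (c i * cnj (c j)) * (if i = j then of_real V else 0)) = of_real (S / V)"
  proof -
    have "(\<Sum>i\<in>I. \<Sum>j\<in>I. (c i * cnj (c j)) * (if i = j then of_real V else 0)) = (\<Sum>i\<in>I. c i * cnj (c i) * of_real V)"
      using I by (simp add: if_distrib cong: if_cong)
    also have "\<dots> = (\<Sum>i\<in>I. cnj (a i) * a i / of_real V)"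
      using V by (intro sum.cong refl) (simp add: c_def field_simps)
    finally show ?thesis using S(2) by (simp flip: sum_divide_distrib)
  qed
  moreover have "(\<lambda>x. \<Sum>i\<in>I. \<Sum>j\<in>I. (c i * cnj (c j)) * (e i x * cnj (e j x))) = (\<lambda>x. P x * cnj (P x))"
    by (simp add: P_def sum_product mult_ac)
  ultimately have hPP: "has_bochner_integral M (\<lambda>x. P x * cnj (P x)) (of_real (S / V))"
    by simp
  \<comment> \<open>The three integrals involving \<open>P\<close> all equal \<open>S / V\<close>,
    so the expanded square integrates to the integral of \<open>g\<^sup>2\<close> minus
    \<open>S / V\<close>.\<close>
  have "has_bochner_integral M
      (\<lambda>x. (of_real (g x) * of_real (g x) - of_real (g x) * P x) - (of_real (g x) * cnj (P x) - P x * cnj (P x)))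
      ((of_real (\<integral>x. (g x)\<^sup>2 \<partial>M) - of_real (S / V)) - (of_real (S / V) - of_real (S / V)))"
    by (intro has_bochner_integral_diff hg hP hcP hPP)
  moreover have "(of_real (g x) * of_real (g x) - of_real (g x) * P x) - (of_real (g x) * cnj (P x) - P x * cnj (P x))
      = complex_of_real ((cmod (of_real (g x) - P x))\<^sup>2)" for x
    unfolding complex_norm_square by (simp add: algebra_simps)
  ultimately have "has_bochner_integral M (\<lambda>x. complex_of_real ((cmod (of_real (g x) - P x))\<^sup>2))
      (of_real ((\<integral>x. (g x)\<^sup>2 \<partial>M) - S / V))"
    by simp
  from has_bochner_integral_bounded_linear[OF bounded_linear_Re this]
  have "has_bochner_integral M (\<lambda>x. (cmod (of_real (g x) - P x))\<^sup>2) ((\<integral>x. (g x)\<^sup>2 \<partial>M) - S / V)"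
    by (simp only: Re_complex_of_real)
  then have "0 \<le> (\<integral>x. (g x)\<^sup>2 \<partial>M) - S / V"
    using Bochner_Integration.integral_nonneg[of M "\<lambda>x. (cmod (of_real (g x) - P x))\<^sup>2"]
    by (simp add: has_bochner_integral_integral_eq)
  then have "S \<le> V * (\<integral>x. (g x)\<^sup>2 \<partial>M)"
    using V by (simp add: field_simps)
  then show ?thesis by (simp add: S_def a_def)
qed

section \<open>Orthogonality of plane waves on a box\<close>

lemma integral_lborel_prod:
  fixes f :: "'a::euclidean_space \<Rightarrow> real \<Rightarrow> complex"
  assumes "\<And>b. b \<in> Basis \<Longrightarrow> integrable lborel (f b)"
  shows "(\<integral>x. (\<Prod>b\<in>Basis. f b (x \<bullet> b)) \<partial>lborel) = (\<Prod>b\<in>Basis. \<integral>t. f b t \<partial>lborel)"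
proof -
  interpret product_sigma_finite "\<lambda>b::'a. lborel :: real measure" by standard
  have [measurable]: "f b \<in> borel_measurable borel" if "b \<in> Basis" for b
    using borel_measurable_integrable[OF assms[OF that]] by simp
  have "(\<integral>x. (\<Prod>b\<in>Basis. f b (x \<bullet> b)) \<partial>lborel)
      = (\<integral>t. (\<Prod>b\<in>Basis. f b ((\<Sum>b\<in>Basis. t b *\<^sub>R b) \<bullet> b)) \<partial>(\<Pi>\<^sub>M b\<in>Basis. lborel))"
    by (subst lborel_eq, subst integral_distr) simp_all
  also have "\<dots> = (\<integral>t. (\<Prod>b\<in>Basis. f b (t b)) \<partial>(\<Pi>\<^sub>M b\<in>Basis. lborel))"
    by simp
  also have "\<dots> = (\<Prod>b\<in>Basis. \<integral>t. f b t \<partial>lborel)"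
    using assms by (intro product_integral_prod) auto
  finally show ?thesis .
qed

text \<open>Since \<open>sin (a * L) = 0\<close>, the wave takes the same value at both ends of the
  interval, and so does its antiderivative.\<close>

lemma integral_cis_Icc:
  assumes L: "0 < L" and a: "a \<noteq> 0" "sin (a * L) = 0"
  shows "has_bochner_integral lborel (\<lambda>t. indicator {-L..L} t *\<^sub>R cis (a * t)) 0"
proof -
  have "has_bochner_integral lborel (\<lambda>t. indicator {-L..L} t *\<^sub>R cis (a * t))
     (cis (a * L) / (\<i> * of_real a) - cis (a * (-L)) / (\<i> * of_real a))"
  proof (rule has_bochner_integral_FTC_Icc)
    show "- L \<le> L" using L by simp
    fix t
    show "((\<lambda>t. cis (a * t) / (\<i> * of_real a)) has_vector_derivative cis (a * t)) (at t within {-L..L})"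
    proof -
      have "((\<lambda>z. exp (\<i> * of_real a * z) / (\<i> * of_real a)) has_field_derivative exp (\<i> * of_real a * of_real t))
          (at (complex_of_real t))"
        using a(1) by (auto intro!: derivative_eq_intros)
      from has_vector_derivative_real_field[OF this] show ?thesis
        by (simp add: cis_conv_exp mult.assoc)
    qed
    show "continuous_on {-L..L} (\<lambda>t. cis (a * t))"
      unfolding cis_conv_exp by (intro continuous_intros)
  qed
  moreover have "cis (a * L) = cis (a * (-L))"
    using a(2) by (simp add: complex_eq_iff)
  ultimately show ?thesis by simp
qed

lemma indicator_cbox_prod:
  fixes x :: "'a::euclidean_space"
  shows "indicator (cbox (- (L *\<^sub>R One)) (L *\<^sub>R One)) x = (\<Prod>b\<in>Basis. indicator {-L..L} (x \<bullet> b) :: complex)"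
proof (cases "\<forall>b\<in>Basis. x \<bullet> b \<in> {-L..L}")
  case True
  then have "x \<in> cbox (- (L *\<^sub>R One)) (L *\<^sub>R One)" by (simp add: mem_box)
  then show ?thesis using True by simp
next
  case False
  then obtain b where b: "b \<in> Basis" "x \<bullet> b \<notin> {-L..L}" by blast
  then have "(\<Prod>b\<in>Basis. indicator {-L..L} (x \<bullet> b) :: complex) = 0"
    by (intro prod_zero bexI[of _ b]) simp_all
  moreover have "x \<notin> cbox (- (L *\<^sub>R One)) (L *\<^sub>R One)" using b by (auto simp: mem_box)
  ultimately show ?thesis by simp
qed

lemma cis_inner_prod: "cis (\<eta> \<bullet> x) = (\<Prod>b\<in>Basis. cis ((\<eta> \<bullet> b) * (x \<bullet> b)))"
  by (simp add: euclidean_inner[of \<eta> x] cis_conv_exp sum_distrib_left exp_sum)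

text \<open>The integral factorises over the coordinates. A zero coordinate of the frequency
  contributes \<open>2 * L\<close>, a nonzero one contributes \<open>0\<close>.\<close>

lemma integral_box_cis:
  fixes \<eta> :: "'a::euclidean_space"
  assumes L: "0 < L" and \<eta>: "\<And>b. b \<in> Basis \<Longrightarrow> sin ((\<eta> \<bullet> b) * L) = 0"
  shows "has_bochner_integral lebesgue (\<lambda>x. indicator (cbox (- (L *\<^sub>R One)) (L *\<^sub>R One)) x * cis (\<eta> \<bullet> x))
    (if \<eta> = 0 then of_real ((2 * L) ^ DIM('a)) else 0)"
proof -
  let ?Q = "cbox (- (L *\<^sub>R One)) (L *\<^sub>R One) :: 'a set"
  define f where "f b t = (indicator {-L..L} t *\<^sub>R cis ((\<eta> \<bullet> b) * t))" for b t
  have f: "has_bochner_integral lborel (f b) (if \<eta> \<bullet> b = 0 then of_real (2 * L) else 0)" if b: "b \<in> Basis" for b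
  proof (cases "\<eta> \<bullet> b = 0")
    case True
    have "has_bochner_integral lborel (\<lambda>t. indicator {-L..L} t :: real) (2 * L)"
      using L by (simp add: has_bochner_integral_iff)
    from has_bochner_integral_of_real[OF this, where 'a = complex] show ?thesis
      using True by (simp add: f_def[abs_def] scaleR_conv_of_real)
  next
    case False
    then show ?thesis using integral_cis_Icc[OF L False \<eta>[OF b]] by (simp add: f_def[abs_def])
  qed
  have eq: "indicator ?Q x * cis (\<eta> \<bullet> x) = (\<Prod>b\<in>Basis. f b (x \<bullet> b))" for x
    unfolding indicator_cbox_prod cis_inner_prod prod.distrib[symmetric] f_def
    by (intro prod.cong refl) (simp add: indicator_def)
  have int: "(\<integral>x. indicator ?Q x * cis (\<eta> \<bullet> x) \<partial>lborel) = (if \<eta> = 0 then of_real ((2 * L) ^ DIM('a)) else 0)"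
  proof -
    have "(\<integral>x. indicator ?Q x * cis (\<eta> \<bullet> x) \<partial>lborel) = (\<Prod>b\<in>Basis. \<integral>t. f b t \<partial>lborel)"
      unfolding eq using f by (intro integral_lborel_prod) (auto simp: has_bochner_integral_iff)
    also have "\<dots> = (\<Prod>b\<in>Basis. if \<eta> \<bullet> b = 0 then of_real (2 * L) else 0)"
      using f by (intro prod.cong refl) (simp add: has_bochner_integral_integral_eq)
    also have "\<dots> = (if \<eta> = 0 then of_real ((2 * L) ^ DIM('a)) else 0)"
    proof (cases "\<eta> = 0")
      case False
      then obtain b where "b \<in> Basis" "\<eta> \<bullet> b \<noteq> 0" using euclidean_all_zero_iff[of \<eta>] by blast
      then show ?thesis using False by (auto intro!: prod_zero)
    qed simp
    finally show ?thesis .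
  qed
  have meas: "(\<lambda>x. indicator ?Q x * cis (\<eta> \<bullet> x)) \<in> borel_measurable lborel"
    unfolding cis_conv_exp by measurable
  have "integrable lborel (\<lambda>x. indicator ?Q x * cis (\<eta> \<bullet> x))"
  proof (rule Bochner_Integration.integrable_bound)
    show "integrable lborel (\<lambda>x. indicator ?Q x :: real)"
      by (intro integrable_real_indicator) (simp, rule emeasure_lborel_cbox_finite)
    show "AE x in lborel. norm (indicator ?Q x * cis (\<eta> \<bullet> x)) \<le> norm (indicator ?Q x :: real)"
      by (intro always_eventually allI) (simp add: norm_mult indicator_def)
  qed (rule meas)
  then show ?thesis
    using int meas by (simp add: has_bochner_integral_iff integrable_completion integral_completion)
qed

text \<open>The hypothesis \<open>lattice\<close> constrains only differences of frequencies, so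
  \<open>I\<close> may lie in any translate of the lattice, as the later averaging requires. Cutting
  the waves off at the box leaves the coefficients unchanged because \<open>g\<close> is supported
  there.\<close>

lemma bessel_box:
  fixes g :: "'a::euclidean_space \<Rightarrow> real"
  assumes I: "finite I" and L: "0 < L"
    and lattice: "\<And>\<xi> \<eta> b. \<lbrakk>\<xi> \<in> I; \<eta> \<in> I; b \<in> Basis\<rbrakk> \<Longrightarrow> sin (((\<xi> - \<eta>) \<bullet> b) * L) = 0"
    and g: "integrable lebesgue g" "integrable lebesgue (\<lambda>x. (g x)\<^sup>2)"
    and supp: "\<And>x. x \<notin> cbox (- (L *\<^sub>R One)) (L *\<^sub>R One) \<Longrightarrow> g x = 0"
  shows "(\<Sum>\<xi>\<in>I. (\<integral>x. g x * cos (\<xi> \<bullet> x) \<partial>lebesgue)\<^sup>2 + (\<integral>x. g x * sin (\<xi> \<bullet> x) \<partial>lebesgue)\<^sup>2)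
    \<le> (2 * L) ^ DIM('a) * (\<integral>x. (g x)\<^sup>2 \<partial>lebesgue)"
proof -
  let ?Q = "cbox (- (L *\<^sub>R One)) (L *\<^sub>R One) :: 'a set"
  define e where "e \<xi> x = (indicator ?Q x * cis (\<xi> \<bullet> x))" for \<xi> x :: 'a
  have ge: "complex_of_real (g x) * e \<xi> x = of_real (g x) * cis (\<xi> \<bullet> x)" for \<xi> x
    using supp[of x] by (cases "x \<in> ?Q") (simp_all add: e_def)
  have int: "integrable lebesgue (\<lambda>x. complex_of_real (g x) * cis (\<xi> \<bullet> x))" for \<xi>
  proof (rule Bochner_Integration.integrable_bound[OF g(1)])
    have "(\<lambda>x. cis (\<xi> \<bullet> x)) \<in> borel_measurable borel" unfolding cis_conv_exp by measurable
    then have "(\<lambda>x. cis (\<xi> \<bullet> x)) \<in> borel_measurable lebesgue" by (intro measurable_completion) simp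
    moreover have "(\<lambda>x. complex_of_real (g x)) \<in> borel_measurable lebesgue"
      using borel_measurable_integrable[OF g(1)] by measurable
    ultimately show "(\<lambda>x. complex_of_real (g x) * cis (\<xi> \<bullet> x)) \<in> borel_measurable lebesgue"
      by (rule borel_measurable_times[rotated])
  qed (simp add: norm_mult)
  have "(\<Sum>\<xi>\<in>I. (cmod (\<integral>x. of_real (g x) * e \<xi> x \<partial>lebesgue))\<^sup>2)
      \<le> (2 * L) ^ DIM('a) * (\<integral>x. (g x)\<^sup>2 \<partial>lebesgue)"
  proof (rule bessel_inequality[OF I _ g(2)])
    show "0 < (2 * L) ^ DIM('a)" using L by simp
    show "integrable lebesgue (\<lambda>x. of_real (g x) * e \<xi> x)" for \<xi> unfolding ge by (rule int)
    fix \<xi> \<eta> assume *: "\<xi> \<in> I" "\<eta> \<in> I"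
    have "e \<xi> x * cnj (e \<eta> x) = indicator ?Q x * cis ((\<xi> - \<eta>) \<bullet> x)" for x
      by (simp add: e_def indicator_def cis_cnj cis_mult inner_diff_left)
    then show "has_bochner_integral lebesgue (\<lambda>x. e \<xi> x * cnj (e \<eta> x))
        (if \<xi> = \<eta> then complex_of_real ((2 * L) ^ DIM('a)) else 0)"
      using integral_box_cis[OF L lattice[OF *]] by simp
  qed
  moreover have "(cmod (\<integral>x. of_real (g x) * e \<xi> x \<partial>lebesgue))\<^sup>2
      = (\<integral>x. g x * cos (\<xi> \<bullet> x) \<partial>lebesgue)\<^sup>2 + (\<integral>x. g x * sin (\<xi> \<bullet> x) \<partial>lebesgue)\<^sup>2" for \<xi>
    unfolding ge cmod_power2
    using integral_Re[OF int[of \<xi>]] integral_Im[OF int[of \<xi>]] by simp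
  ultimately show ?thesis by simp
qed

section \<open>Plane waves as test functions\<close>

lemma Ck_plane_waves: "Ck m (\<lambda>x. cos (\<xi> \<bullet> x))" "Ck m (\<lambda>x. sin (\<xi> \<bullet> x))"
  using Ck_compose[OF conjunct1[OF Ck_cos_sin] Ck_inner] Ck_compose[OF conjunct2[OF Ck_cos_sin] Ck_inner]
  by (simp_all add: inner_commute[of \<xi>])

lemma grad_plane_waves:
  assumes u: "u \<in> Cc_infinity"
  shows "grad (\<lambda>x. u x * cos (\<xi> \<bullet> x)) x = u x *\<^sub>R (- sin (\<xi> \<bullet> x) *\<^sub>R \<xi>) + cos (\<xi> \<bullet> x) *\<^sub>R grad u x"
    and "grad (\<lambda>x. u x * sin (\<xi> \<bullet> x)) x = u x *\<^sub>R (cos (\<xi> \<bullet> x) *\<^sub>R \<xi>) + sin (\<xi> \<bullet> x) *\<^sub>R grad u x"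
proof -
  have i: "GDERIV (\<lambda>x. \<xi> \<bullet> x) x :> \<xi>"
    unfolding gderiv_def by (auto intro!: derivative_eq_intros simp: inner_commute)
  show "grad (\<lambda>x. u x * cos (\<xi> \<bullet> x)) x = u x *\<^sub>R (- sin (\<xi> \<bullet> x) *\<^sub>R \<xi>) + cos (\<xi> \<bullet> x) *\<^sub>R grad u x"
    by (rule grad_eqI[OF GDERIV_mult[OF GDERIV_grad[OF u] GDERIV_DERIV_compose[OF i DERIV_cos]]])
  show "grad (\<lambda>x. u x * sin (\<xi> \<bullet> x)) x = u x *\<^sub>R (cos (\<xi> \<bullet> x) *\<^sub>R \<xi>) + sin (\<xi> \<bullet> x) *\<^sub>R grad u x"
    by (rule grad_eqI[OF GDERIV_mult[OF GDERIV_grad[OF u] GDERIV_DERIV_compose[OF i DERIV_sin]]])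
qed

text \<open>The left side is the squared modulus of the gradient of
  \<open>u(x) e\<^sup>i\<^sup>\<xi>\<^sup>x\<close>. As \<open>u\<close> is real, the cross terms of
  the cosine and sine parts cancel.\<close>

lemma plane_waves_energy_density:
  assumes u: "u \<in> Cc_infinity"
  shows "grad (\<lambda>x. u x * cos (\<xi> \<bullet> x)) x \<bullet> grad (\<lambda>x. u x * cos (\<xi> \<bullet> x)) x
      + grad (\<lambda>x. u x * sin (\<xi> \<bullet> x)) x \<bullet> grad (\<lambda>x. u x * sin (\<xi> \<bullet> x)) x
    = grad u x \<bullet> grad u x + (norm \<xi>)\<^sup>2 * (u x * u x)"
proof -
  have "(u * (- s)) * (u * (- s)) * X + 2 * (u * (- s) * c * Y) + c * c * Z
      + ((u * c) * (u * c) * X + 2 * (u * c * s * Y) + s * s * Z) = Z + X * (u * u)"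
    if "s\<^sup>2 + c\<^sup>2 = 1" for u s c X Y Z :: real
  proof -
    have "(u * (- s)) * (u * (- s)) * X + 2 * (u * (- s) * c * Y) + c * c * Z
      + ((u * c) * (u * c) * X + 2 * (u * c * s * Y) + s * s * Z) = (s\<^sup>2 + c\<^sup>2) * (Z + X * (u * u))"
      by (simp add: power2_eq_square algebra_simps)
    then show ?thesis using that by simp
  qed
  from this[OF sin_cos_squared_add[of "\<xi> \<bullet> x"], of "u x" "\<xi> \<bullet> \<xi>" "\<xi> \<bullet> grad u x" "grad u x \<bullet> grad u x"]
  show ?thesis
    unfolding grad_plane_waves[OF u] power2_norm_eq_inner
    by (simp add: inner_add_left inner_add_right inner_commute algebra_simps)
qed

context weight
begin

text \<open>The spectral lower bound is summed over both parts of all waves. Each pair has mass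
  \<open>m\<close>, independent of \<xi>, and energy \<open>e + (norm \<xi>)\<^sup>2 * m\<close>, so
  only the projections onto \<Phi> call for an estimate.\<close>

lemma key_inequality:
  fixes \<kappa> :: "'a \<Rightarrow> real" and I :: "'a set"
  assumes \<kappa>: "\<kappa> \<in> Cc_infinity" "\<And>x. \<bar>\<kappa> x\<bar> \<le> 1"
    and supp: "\<And>x. x \<notin> cbox (- (L *\<^sub>R One)) (L *\<^sub>R One) \<Longrightarrow> \<kappa> x = 0"
    and I: "finite I" and L: "0 < L"
    and lattice: "\<And>\<xi> \<eta> b. \<lbrakk>\<xi> \<in> I; \<eta> \<in> I; b \<in> Basis\<rbrakk> \<Longrightarrow> sin (((\<xi> - \<eta>) \<bullet> b) * L) = 0"
    and M: "0 \<le> M" "ereal M < mu k \<rho>" and K: "0 \<le> K"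
  shows "(\<integral>x. \<rho> x * (\<kappa> x * \<kappa> x) \<partial>lebesgue) * (\<Sum>\<xi>\<in>I. M - (norm \<xi>)\<^sup>2)
    \<le> M * (real k * ((2 * L) ^ DIM('a) * K)) + real (card I) * (\<integral>x. \<rho> x * (grad \<kappa> x \<bullet> grad \<kappa> x) \<partial>lebesgue)"
proof -
  define m where "m = (\<integral>x. \<rho> x * (\<kappa> x * \<kappa> x) \<partial>lebesgue)"
  define e where "e = (\<integral>x. \<rho> x * (grad \<kappa> x \<bullet> grad \<kappa> x) \<partial>lebesgue)"
  define c where "c \<xi> x = \<kappa> x * cos (\<xi> \<bullet> x)" for \<xi> x :: 'a
  define s where "s \<xi> x = \<kappa> x * sin (\<xi> \<bullet> x)" for \<xi> x :: 'a
  have cs: "c \<xi> \<in> Cc_infinity" "s \<xi> \<in> Cc_infinity" for \<xi>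
    unfolding c_def[abs_def] s_def[abs_def] by (intro Cc_infinity_mult \<kappa>(1) Ck_plane_waves)+
  define C where "C \<xi> = restrict_pos \<rho> (c \<xi>)" for \<xi>
  define S where "S \<xi> = restrict_pos \<rho> (s \<xi>)" for \<xi>
  have mass: "mass (C \<xi>) (C \<xi>) + mass (S \<xi>) (S \<xi>) = m" for \<xi>
  proof -
    have "(p * c) * (p * c) + (p * s) * (p * s) = (s\<^sup>2 + c\<^sup>2) * (p * p)" for p c s :: real
      by (simp add: power2_eq_square algebra_simps)
    from this[of "\<kappa> x" "cos (\<xi> \<bullet> x)" "sin (\<xi> \<bullet> x)" for x]
    have "c \<xi> x * c \<xi> x + s \<xi> x * s \<xi> x = \<kappa> x * \<kappa> x" for x
      by (simp add: c_def s_def)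
    then have "\<rho> x * (c \<xi> x * c \<xi> x) + \<rho> x * (s \<xi> x * s \<xi> x) = \<rho> x * (\<kappa> x * \<kappa> x)" for x
      by (simp add: distrib_left[symmetric])
    moreover have "mass (C \<xi>) (C \<xi>) + mass (S \<xi>) (S \<xi>)
        = (\<integral>x. \<rho> x * (c \<xi> x * c \<xi> x) + \<rho> x * (s \<xi> x * s \<xi> x) \<partial>lebesgue)"
      unfolding C_def S_def mass_restrict_pos[OF cs(1) cs(1)] mass_restrict_pos[OF cs(2) cs(2)]
      by (rule Bochner_Integration.integral_add[OF integrable_mass[OF cs(1) cs(1)] integrable_mass[OF cs(2) cs(2)], symmetric])
    ultimately show ?thesis by (simp add: m_def)
  qed
  have energy: "energy (C \<xi>) (C \<xi>) + energy (S \<xi>) (S \<xi>) = e + (norm \<xi>)\<^sup>2 * m" for \<xi>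
  proof -
    have "\<rho> x * (grad (c \<xi>) x \<bullet> grad (c \<xi>) x) + \<rho> x * (grad (s \<xi>) x \<bullet> grad (s \<xi>) x)
        = \<rho> x * (grad \<kappa> x \<bullet> grad \<kappa> x) + (norm \<xi>)\<^sup>2 * (\<rho> x * (\<kappa> x * \<kappa> x))" for x
      unfolding distrib_left[symmetric] c_def[abs_def] s_def[abs_def] plane_waves_energy_density[OF \<kappa>(1)]
      by (simp add: distrib_left)
    moreover have "energy (C \<xi>) (C \<xi>) + energy (S \<xi>) (S \<xi>)
        = (\<integral>x. \<rho> x * (grad (c \<xi>) x \<bullet> grad (c \<xi>) x) + \<rho> x * (grad (s \<xi>) x \<bullet> grad (s \<xi>) x) \<partial>lebesgue)"
      unfolding C_def S_def energy_restrict_pos[OF cs(1) cs(1)] energy_restrict_pos[OF cs(2) cs(2)]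
      by (rule Bochner_Integration.integral_add[OF integrable_energy[OF cs(1) cs(1)] integrable_energy[OF cs(2) cs(2)], symmetric])
    moreover have "(\<integral>x. \<rho> x * (grad \<kappa> x \<bullet> grad \<kappa> x) + (norm \<xi>)\<^sup>2 * (\<rho> x * (\<kappa> x * \<kappa> x)) \<partial>lebesgue) = e + (norm \<xi>)\<^sup>2 * m"
      unfolding e_def m_def
      by (simp add: Bochner_Integration.integral_add integrable_energy integrable_mass \<kappa>(1))
    ultimately show ?thesis by simp
  qed
  have "finite (C ` I \<union> S ` I)" "C ` I \<union> S ` I \<subseteq> restricted_space \<rho>"
    using I by (auto simp: C_def S_def restrict_pos_mem cs)
  from spectral_lower_bound[OF M(2) this] obtain \<Phi> where
    \<Phi>: "finite \<Phi>" "\<Phi> \<subseteq> restricted_space \<rho>" "card \<Phi> \<le> k" "\<And>\<phi>. \<phi> \<in> \<Phi> \<Longrightarrow> mass \<phi> \<phi> = 1"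
    and low: "\<And>f. f \<in> C ` I \<union> S ` I \<Longrightarrow> M * (mass f f - (\<Sum>\<phi>\<in>\<Phi>. (mass f \<phi>)\<^sup>2)) \<le> energy f f"
    by metis
  \<comment> \<open>With a representative \<open>w\<close> of \<phi>, the projections are Fourier
    integrals of \<open>\<rho> * \<kappa> * w\<close> over the box. The square of this function is
    at most \<open>K * \<rho> * w\<^sup>2\<close>, whose integral is \<open>K\<close> since \<phi>
    has mass one. The bound does not grow with the number of frequencies.\<close>
  have bessel: "(\<Sum>\<xi>\<in>I. (mass (C \<xi>) \<phi>)\<^sup>2 + (mass (S \<xi>) \<phi>)\<^sup>2) \<le> (2 * L) ^ DIM('a) * K" if "\<phi> \<in> \<Phi>" for \<phi>
  proof -
    have "\<phi> \<in> restricted_space \<rho>" using that \<Phi>(2) by auto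
    then obtain w where w: "w \<in> Cc_infinity" and ph: "\<phi> = restrict_pos \<rho> w"
      by (rule restricted_spaceE)
    have w1: "(\<integral>x. \<rho> x * (w x * w x) \<partial>lebesgue) = 1"
      using \<Phi>(4)[OF that] by (simp add: ph mass_restrict_pos w)
    define g where "g x = \<rho> x * (\<kappa> x * w x)" for x
    have g1: "integrable lebesgue g"
      unfolding g_def[abs_def] by (rule integrable_mass[OF \<kappa>(1) w])
    have le: "AE x in lebesgue. (g x)\<^sup>2 \<le> K * (\<rho> x * (w x * w x))"
      using weight_nonneg weight_le
    proof eventually_elim
      fix x assume x: "0 \<le> \<rho> x" "\<rho> x \<le> K"
      have "(\<kappa> x)\<^sup>2 \<le> 1" using \<kappa>(2)[of x] by (simp add: abs_square_le_1)
      then have "(\<kappa> x)\<^sup>2 * (\<rho> x)\<^sup>2 \<le> 1 * (K * \<rho> x)"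
        unfolding power2_eq_square[of "\<rho> x"] using x K by (intro mult_mono mult_right_mono) auto
      then have "((\<kappa> x)\<^sup>2 * (\<rho> x)\<^sup>2) * (w x)\<^sup>2 \<le> (1 * (K * \<rho> x)) * (w x)\<^sup>2"
        by (intro mult_right_mono) auto
      then show "(g x)\<^sup>2 \<le> K * (\<rho> x * (w x * w x))"
        by (simp add: g_def power_mult_distrib power2_eq_square mult_ac)
    qed
    have int: "integrable lebesgue (\<lambda>x. K * (\<rho> x * (w x * w x)))"
      by (intro integrable_mult_right integrable_mass w)
    have g2: "integrable lebesgue (\<lambda>x. (g x)\<^sup>2)"
    proof (rule Bochner_Integration.integrable_bound[OF int])
      show "(\<lambda>x. (g x)\<^sup>2) \<in> borel_measurable lebesgue"
        using borel_measurable_integrable[OF g1] by measurable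
      show "AE x in lebesgue. norm ((g x)\<^sup>2) \<le> norm (K * (\<rho> x * (w x * w x)))"
        using le by eventually_elim simp
    qed
    have "(\<integral>x. (g x)\<^sup>2 \<partial>lebesgue) \<le> (\<integral>x. K * (\<rho> x * (w x * w x)) \<partial>lebesgue)"
      by (rule integral_mono_AE[OF g2 int le])
    also have "\<dots> = K" using w1 by simp
    finally have gK: "(\<integral>x. (g x)\<^sup>2 \<partial>lebesgue) \<le> K" .
    have "mass (C \<xi>) \<phi> = (\<integral>x. g x * cos (\<xi> \<bullet> x) \<partial>lebesgue)" "mass (S \<xi>) \<phi> = (\<integral>x. g x * sin (\<xi> \<bullet> x) \<partial>lebesgue)" for \<xi>
      unfolding C_def S_def ph mass_restrict_pos[OF cs(1) w] mass_restrict_pos[OF cs(2) w]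
      by (simp_all add: c_def s_def g_def mult_ac)
    then have "(\<Sum>\<xi>\<in>I. (mass (C \<xi>) \<phi>)\<^sup>2 + (mass (S \<xi>) \<phi>)\<^sup>2) \<le> (2 * L) ^ DIM('a) * (\<integral>x. (g x)\<^sup>2 \<partial>lebesgue)"
      using bessel_box[OF I L lattice g1 g2] supp by (simp add: g_def)
    also have "\<dots> \<le> (2 * L) ^ DIM('a) * K"
      using gK L by (intro mult_left_mono) auto
    finally show ?thesis .
  qed
  have "M * (real (card I) * m - (\<Sum>\<phi>\<in>\<Phi>. \<Sum>\<xi>\<in>I. (mass (C \<xi>) \<phi>)\<^sup>2 + (mass (S \<xi>) \<phi>)\<^sup>2))
      = (\<Sum>\<xi>\<in>I. M * (mass (C \<xi>) (C \<xi>) - (\<Sum>\<phi>\<in>\<Phi>. (mass (C \<xi>) \<phi>)\<^sup>2))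
        + M * (mass (S \<xi>) (S \<xi>) - (\<Sum>\<phi>\<in>\<Phi>. (mass (S \<xi>) \<phi>)\<^sup>2)))"
  proof -
    have "M * (mass (C \<xi>) (C \<xi>) - (\<Sum>\<phi>\<in>\<Phi>. (mass (C \<xi>) \<phi>)\<^sup>2)) + M * (mass (S \<xi>) (S \<xi>) - (\<Sum>\<phi>\<in>\<Phi>. (mass (S \<xi>) \<phi>)\<^sup>2))
        = M * (m - (\<Sum>\<phi>\<in>\<Phi>. (mass (C \<xi>) \<phi>)\<^sup>2 + (mass (S \<xi>) \<phi>)\<^sup>2))" for \<xi>
      unfolding mass[of \<xi>, symmetric] sum.distrib by (simp add: algebra_simps)
    then have "(\<Sum>\<xi>\<in>I. M * (mass (C \<xi>) (C \<xi>) - (\<Sum>\<phi>\<in>\<Phi>. (mass (C \<xi>) \<phi>)\<^sup>2))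
        + M * (mass (S \<xi>) (S \<xi>) - (\<Sum>\<phi>\<in>\<Phi>. (mass (S \<xi>) \<phi>)\<^sup>2)))
      = M * (\<Sum>\<xi>\<in>I. m - (\<Sum>\<phi>\<in>\<Phi>. (mass (C \<xi>) \<phi>)\<^sup>2 + (mass (S \<xi>) \<phi>)\<^sup>2))"
      by (simp add: sum_distrib_left)
    then show ?thesis unfolding sum_subtractf by (subst (asm) sum.swap[of _ \<Phi> I]) simp
  qed
  also have "\<dots> \<le> (\<Sum>\<xi>\<in>I. energy (C \<xi>) (C \<xi>) + energy (S \<xi>) (S \<xi>))"
    by (intro sum_mono add_mono low) auto
  also have "\<dots> = real (card I) * e + m * (\<Sum>\<xi>\<in>I. (norm \<xi>)\<^sup>2)"
    by (simp add: energy sum.distrib sum_distrib_left mult.commute)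
  finally have main: "M * (real (card I) * m - (\<Sum>\<phi>\<in>\<Phi>. \<Sum>\<xi>\<in>I. (mass (C \<xi>) \<phi>)\<^sup>2 + (mass (S \<xi>) \<phi>)\<^sup>2))
      \<le> real (card I) * e + m * (\<Sum>\<xi>\<in>I. (norm \<xi>)\<^sup>2)" .
  have "(\<Sum>\<phi>\<in>\<Phi>. \<Sum>\<xi>\<in>I. (mass (C \<xi>) \<phi>)\<^sup>2 + (mass (S \<xi>) \<phi>)\<^sup>2) \<le> real (card \<Phi>) * ((2 * L) ^ DIM('a) * K)"
    using bessel by (rule sum_bounded_above)
  also have "\<dots> \<le> real k * ((2 * L) ^ DIM('a) * K)"
    using \<Phi>(3) K L by (intro mult_right_mono) auto
  finally have "M * (\<Sum>\<phi>\<in>\<Phi>. \<Sum>\<xi>\<in>I. (mass (C \<xi>) \<phi>)\<^sup>2 + (mass (S \<xi>) \<phi>)\<^sup>2) \<le> M * (real k * ((2 * L) ^ DIM('a) * K))"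
    using M(1) by (rule mult_left_mono)
  with main show ?thesis
    unfolding m_def[symmetric] e_def[symmetric] by (simp add: sum_subtractf algebra_simps)
qed

end

section \<open>Lattice averages\<close>

text \<open>\<open>ennreal\<close> sends negative reals to \<open>0\<close>, so the integrand is the
  positive part. It is the integral of \<open>2 * s\<close> for \<open>s\<close> from
  \<open>norm \<eta>\<close> to \<open>r\<close>; after Fubini the inner integral is
  \<open>2 * s\<close> times the volume of the ball of radius \<open>s\<close>.\<close>

lemma nn_integral_ball_deficit:
  assumes r: "0 \<le> r"
  shows "(\<integral>\<^sup>+\<eta>. ennreal (r\<^sup>2 - (norm (\<eta> :: 'a::euclidean_space))\<^sup>2) \<partial>lborel)
    = ennreal (2 * unit_ball_vol DIM('a) * r ^ (DIM('a) + 2) / (DIM('a) + 2))"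
proof -
  let ?N = "DIM('a)"
  define \<omega> where "\<omega> = unit_ball_vol ?N"
  have w0: "0 \<le> \<omega>" by (simp add: \<omega>_def)
  define g where "g s \<eta> = ennreal (2 * s) * indicator {0..r} s * indicator {p. norm (snd p) \<le> fst p} (s, \<eta>)"
    for s :: real and \<eta> :: 'a
  have "(\<integral>\<^sup>+s. g s \<eta> \<partial>lborel) = ennreal (r\<^sup>2 - (norm \<eta>)\<^sup>2)" for \<eta>
  proof (cases "norm \<eta> \<le> r")
    case True
    have "(\<integral>\<^sup>+s. ennreal (2 * s) * indicator {norm \<eta>..r} s \<partial>lborel) = ennreal (r\<^sup>2 - (norm \<eta>)\<^sup>2)"
    proof (rule nn_integral_FTC_Icc)
      fix s assume "s \<in> {norm \<eta>..r}"
      then show "0 \<le> 2 * s" using norm_ge_zero[of \<eta>] by (simp del: norm_ge_zero)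
      show "((\<lambda>s. s\<^sup>2) has_real_derivative 2 * s) (at s)"
        by (auto intro!: derivative_eq_intros)
    qed (use True in auto)
    moreover have "g s \<eta> = ennreal (2 * s) * indicator {norm \<eta>..r} s" for s
      using norm_ge_zero[of \<eta>] by (auto simp: g_def indicator_def simp del: norm_ge_zero)
    ultimately show ?thesis by simp
  next
    case False
    then have "g s \<eta> = 0" for s by (auto simp: g_def indicator_def)
    moreover have "r\<^sup>2 \<le> (norm \<eta>)\<^sup>2" using False r by (intro power_mono) auto
    ultimately show ?thesis by (simp add: ennreal_neg)
  qed
  then have "(\<integral>\<^sup>+\<eta>. ennreal (r\<^sup>2 - (norm (\<eta>::'a))\<^sup>2) \<partial>lborel) = (\<integral>\<^sup>+\<eta>. \<integral>\<^sup>+s. g s \<eta> \<partial>lborel \<partial>lborel)"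
    by simp
  also have "\<dots> = (\<integral>\<^sup>+s. \<integral>\<^sup>+\<eta>. g s \<eta> \<partial>lborel \<partial>lborel)"
  proof -
    have [measurable]: "{p :: real \<times> 'a. norm (snd p) \<le> fst p} \<in> sets (borel \<Otimes>\<^sub>M borel)"
      unfolding borel_prod by (intro borel_closed closed_Collect_le continuous_intros)
    show ?thesis unfolding g_def by (intro lborel_pair.Fubini') measurable
  qed
  also have "\<dots> = (\<integral>\<^sup>+s. ennreal (2 * \<omega> * s ^ (?N + 1)) * indicator {0..r} s \<partial>lborel)"
  proof (rule nn_integral_cong)
    fix s :: real
    show "(\<integral>\<^sup>+\<eta>. g s \<eta> \<partial>lborel) = ennreal (2 * \<omega> * s ^ (?N + 1)) * indicator {0..r} s"
    proof (cases "s \<in> {0..r}")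
      case True
      then have "g s \<eta> = ennreal (2 * s) * indicator (cball 0 s) \<eta>" for \<eta>
        by (simp add: g_def indicator_def)
      then have "(\<integral>\<^sup>+\<eta>. g s \<eta> \<partial>lborel) = ennreal (2 * s) * ennreal (\<omega> * s ^ ?N)"
        using True by (simp add: nn_integral_cmult_indicator emeasure_cball \<omega>_def)
      also have "\<dots> = ennreal (2 * \<omega> * s ^ (?N + 1))"
        using True w0 by (simp add: mult_ac flip: ennreal_mult)
      finally show ?thesis using True by simp
    qed (simp add: g_def)
  qed
  also have "\<dots> = ennreal (2 * \<omega> * r ^ (?N + 2) / (?N + 2) - 2 * \<omega> * 0 ^ (?N + 2) / (?N + 2))"
  proof (rule nn_integral_FTC_Icc)
    fix s assume "s \<in> {0..r}"
    then show "0 \<le> 2 * \<omega> * s ^ (?N + 1)" using w0 by simp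
    have "((\<lambda>s. 2 * \<omega> * s ^ (?N + 2) / (?N + 2)) has_real_derivative
        2 * \<omega> * (real (?N + 2) * s ^ (?N + 1)) / (?N + 2)) (at s)"
      by (rule derivative_eq_intros refl | simp)+
    then show "((\<lambda>s. 2 * \<omega> * s ^ (?N + 2) / (?N + 2)) has_real_derivative 2 * \<omega> * s ^ (?N + 1)) (at s)"
      by (simp add: mult.assoc)
  qed (use r in auto)
  finally show ?thesis by (simp add: \<omega>_def)
qed

section \<open>Finite pieces of a cubic lattice and averages over their translates\<close>

definition lattice_points :: "real \<Rightarrow> nat \<Rightarrow> 'a::euclidean_space set" where
  "lattice_points h n = (\<lambda>f. \<Sum>b\<in>Basis. (h * of_int (f b)) *\<^sub>R b) ` (PiE Basis (\<lambda>_. {-int n..int n}))"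

lemma finite_lattice_points: "finite (lattice_points h n)"
  unfolding lattice_points_def by (intro finite_imageI finite_PiE) auto

lemma card_lattice_points: "card (lattice_points h n :: 'a::euclidean_space set) \<le> (2 * n + 1) ^ DIM('a)"
proof -
  have "card (lattice_points h n :: 'a set) \<le> card (PiE (Basis :: 'a set) (\<lambda>_. {-int n..int n}))"
    unfolding lattice_points_def by (intro card_image_le finite_PiE) auto
  also have "\<dots> = (2 * n + 1) ^ DIM('a)"
    by (simp add: card_PiE nat_add_distrib nat_mult_distrib)
  finally show ?thesis .
qed

lemma lattice_points_inner:
  assumes "\<xi> \<in> lattice_points h n" "b \<in> Basis" shows "\<exists>m::int. \<xi> \<bullet> b = h * of_int m"
proof -
  obtain f where "\<xi> = (\<Sum>b\<in>Basis. (h * of_int (f b)) *\<^sub>R b)"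
    using assms(1) unfolding lattice_points_def by blast
  then have "\<xi> \<bullet> b = h * of_int (f b)" using assms(2) by simp
  then show ?thesis ..
qed

text \<open>Round the coordinates of \<open>x / h\<close> down. The bound on \<open>norm x\<close>
  keeps the resulting integers in the index range.\<close>

lemma lattice_points_cover:
  fixes x :: "'a::euclidean_space"
  assumes h: "0 < h" and x: "norm x \<le> h * n"
  shows "\<exists>\<xi>\<in>lattice_points h n. x - \<xi> \<in> cbox 0 (h *\<^sub>R One)"
proof -
  define f where "f = restrict (\<lambda>b. \<lfloor>(x \<bullet> b) / h\<rfloor>) (Basis :: 'a set)"
  define \<xi> where "\<xi> = (\<Sum>b\<in>Basis. (h * of_int (f b)) *\<^sub>R b)"
  have "f \<in> PiE Basis (\<lambda>_. {-int n..int n})"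
  proof (rule PiE_I)
    fix b :: 'a assume b: "b \<in> Basis"
    have "\<bar>x \<bullet> b\<bar> \<le> h * n" using Basis_le_norm[OF b, of x] x by simp
    then have "- real n \<le> (x \<bullet> b) / h" "(x \<bullet> b) / h \<le> real n"
      using h by (simp_all add: field_simps abs_le_iff)
    then show "f b \<in> {-int n..int n}"
      using b by (simp add: f_def le_floor_iff floor_le_iff)
  qed (simp add: f_def)
  then have "\<xi> \<in> lattice_points h n" unfolding \<xi>_def lattice_points_def by blast
  moreover have "x - \<xi> \<in> cbox 0 (h *\<^sub>R One)"
    unfolding mem_box
  proof (intro ballI conjI)
    fix b :: 'a assume b: "b \<in> Basis"
    define q where "q = real_of_int \<lfloor>(x \<bullet> b) / h\<rfloor>"
    have e: "(x - \<xi>) \<bullet> b = x \<bullet> b - h * q"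
      using b by (simp add: inner_diff_left \<xi>_def f_def q_def)
    have "q \<le> (x \<bullet> b) / h" "(x \<bullet> b) / h \<le> q + 1"
      unfolding q_def by linarith+
    then have "h * q \<le> x \<bullet> b" "x \<bullet> b \<le> h * q + h"
      using h by (simp_all add: field_simps)
    then show "0 \<bullet> b \<le> (x - \<xi>) \<bullet> b" "(x - \<xi>) \<bullet> b \<le> (h *\<^sub>R One) \<bullet> b"
      unfolding e using b by simp_all
  qed
  ultimately show ?thesis ..
qed

text \<open>Averaging over translates of the lattice turns the integral into lattice sums without
  any Riemann sum estimate.\<close>

lemma nn_integral_le_lattice_sums:
  fixes g :: "'a::euclidean_space \<Rightarrow> ennreal"
  assumes h: "0 < h" and g [measurable]: "g \<in> borel_measurable borel"
    and supp: "\<And>x. h * real n < norm x \<Longrightarrow> g x = 0"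
    and bound: "\<And>\<theta>. (\<Sum>\<xi>\<in>lattice_points h n. g (\<xi> + \<theta>)) \<le> c"
  shows "(\<integral>\<^sup>+x. g x \<partial>lborel) \<le> c * ennreal (h ^ DIM('a))"
proof -
  let ?Q = "cbox 0 (h *\<^sub>R One) :: 'a set" and ?Z = "lattice_points h n :: 'a set"
  \<comment> \<open>The closed cells share faces, where \<open>x\<close> is counted several times;
    for an upper bound this is harmless.\<close>
  have "g x \<le> (\<Sum>\<xi>\<in>?Z. g x * indicator ?Q (x - \<xi>))" for x
  proof (cases "norm x \<le> h * n")
    case True
    then obtain \<xi> where xi: "\<xi> \<in> ?Z" "x - \<xi> \<in> ?Q" using lattice_points_cover[OF h] by blast
    then have "g x = g x * indicator ?Q (x - \<xi>)" by simp
    also have "\<dots> \<le> (\<Sum>\<xi>\<in>?Z. g x * indicator ?Q (x - \<xi>))"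
      using xi(1) finite_lattice_points by (intro member_le_sum) auto
    finally show ?thesis .
  qed (simp add: supp)
  then have "(\<integral>\<^sup>+x. g x \<partial>lborel) \<le> (\<integral>\<^sup>+x. (\<Sum>\<xi>\<in>?Z. g x * indicator ?Q (x - \<xi>)) \<partial>lborel)"
    by (intro nn_integral_mono)
  also have "\<dots> = (\<Sum>\<xi>\<in>?Z. \<integral>\<^sup>+x. g x * indicator ?Q (x - \<xi>) \<partial>lborel)"
    by (intro nn_integral_sum) measurable
  \<comment> \<open>Translation invariance moves every cell to the one at the origin. The whole
    integral thus becomes an integral over \<theta> of lattice sums, to which \<open>bound\<close>
    applies.\<close>
  also have "\<dots> = (\<Sum>\<xi>\<in>?Z. \<integral>\<^sup>+\<theta>. g (\<xi> + \<theta>) * indicator ?Q \<theta> \<partial>lborel)"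
  proof (rule sum.cong[OF refl])
    fix \<xi> :: 'a
    have "(\<integral>\<^sup>+x. g x * indicator ?Q (x - \<xi>) \<partial>lborel) = (\<integral>\<^sup>+x. g x * indicator ?Q (x - \<xi>) \<partial>(distr lborel borel ((+) \<xi>)))"
      by (simp add: lborel_distr_plus)
    also have "\<dots> = (\<integral>\<^sup>+\<theta>. g (\<xi> + \<theta>) * indicator ?Q \<theta> \<partial>lborel)"
      by (subst nn_integral_distr) (auto simp: measurable_def[symmetric])
    finally show "(\<integral>\<^sup>+x. g x * indicator ?Q (x - \<xi>) \<partial>lborel) = (\<integral>\<^sup>+\<theta>. g (\<xi> + \<theta>) * indicator ?Q \<theta> \<partial>lborel)" .
  qed
  also have "\<dots> = (\<integral>\<^sup>+\<theta>. (\<Sum>\<xi>\<in>?Z. g (\<xi> + \<theta>) * indicator ?Q \<theta>) \<partial>lborel)"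
    by (intro nn_integral_sum[symmetric]) measurable
  also have "\<dots> \<le> (\<integral>\<^sup>+\<theta>. c * indicator ?Q \<theta> \<partial>lborel)"
    using bound by (intro nn_integral_mono) (simp add: mult_right_mono flip: sum_distrib_right)
  also have "\<dots> = c * emeasure lborel ?Q" by (simp add: nn_integral_cmult)
  also have "emeasure lborel ?Q = ennreal (h ^ DIM('a))"
    using h by (subst emeasure_lborel_cbox) simp_all
  finally show ?thesis .
qed

section \<open>Kroeger's bound\<close>

lemma cutoff_Cc_infinity: "0 < R \<Longrightarrow> cutoff R \<in> Cc_infinity"
  by (rule Cc_infinityI[OF Ck_cutoff, where R = R]) (simp add: cutoff_eq_0)

context weight
begin

lemma cutoff_mass_tendsto:
  assumes R: "filterlim R at_top sequentially"
  shows "(\<lambda>j. \<integral>x. \<rho> x * (cutoff (R j) x * cutoff (R j) x) \<partial>lebesgue) \<longlonglongrightarrow> (\<integral>x. \<rho> x \<partial>lebesgue)"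
proof (rule integral_dominated_convergence[where w = "\<lambda>x. \<bar>\<rho> x\<bar>"])
  show "(\<lambda>x. \<rho> x * (cutoff (R j) x * cutoff (R j) x)) \<in> borel_measurable lebesgue" for j
    using continuous_imp_lebesgue_measurable[OF Ck_continuous[OF Ck_cutoff]] by measurable
  show "AE x in lebesgue. (\<lambda>j. \<rho> x * (cutoff (R j) x * cutoff (R j) x)) \<longlonglongrightarrow> \<rho> x"
  proof (rule AE_I2)
    fix x :: 'a
    have "(\<lambda>j. \<rho> x * (cutoff (R j) x * cutoff (R j) x)) \<longlonglongrightarrow> \<rho> x * (1 * 1)"
      by (intro tendsto_mult tendsto_const cutoff_tendsto R)
    then show "(\<lambda>j. \<rho> x * (cutoff (R j) x * cutoff (R j) x)) \<longlonglongrightarrow> \<rho> x" by simp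
  qed
  show "AE x in lebesgue. norm (\<rho> x * (cutoff (R j) x * cutoff (R j) x)) \<le> \<bar>\<rho> x\<bar>" for j
  proof (rule AE_I2)
    fix x :: 'a
    have "\<bar>cutoff (R j) x * cutoff (R j) x\<bar> \<le> 1"
      using cutoff_bounds[of "R j" x] by (simp add: abs_mult mult_le_one)
    then have "\<bar>\<rho> x\<bar> * \<bar>cutoff (R j) x * cutoff (R j) x\<bar> \<le> \<bar>\<rho> x\<bar> * 1"
      by (intro mult_left_mono) auto
    then show "norm (\<rho> x * (cutoff (R j) x * cutoff (R j) x)) \<le> \<bar>\<rho> x\<bar>"
      by (simp add: abs_mult)
  qed
qed (use integrable_weight in auto)

lemma cutoff_energy_le:
  assumes R: "0 < R"
  shows "(\<integral>x. \<rho> x * (grad (cutoff R) x \<bullet> grad (cutoff R) x) \<partial>lebesgue) \<le> (4 * exp 1 / R)\<^sup>2 * (\<integral>x. \<rho> x \<partial>lebesgue)"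
proof -
  have C: "cutoff R \<in> Cc_infinity" by (rule cutoff_Cc_infinity[OF R])
  have "(\<integral>x. \<rho> x * (grad (cutoff R) x \<bullet> grad (cutoff R) x) \<partial>lebesgue) \<le> (\<integral>x. (4 * exp 1 / R)\<^sup>2 * \<rho> x \<partial>lebesgue)"
  proof (rule integral_mono_AE)
    show "AE x in lebesgue. \<rho> x * (grad (cutoff R) x \<bullet> grad (cutoff R) x) \<le> (4 * exp 1 / R)\<^sup>2 * \<rho> x"
      using weight_nonneg
    proof eventually_elim
      fix x assume "0 \<le> \<rho> x"
      moreover have "(norm (grad (cutoff R) x))\<^sup>2 \<le> (4 * exp 1 / R)\<^sup>2"
        using norm_gradient_cutoff_le[OF R GDERIV_grad[OF C]] by (intro power_mono) auto
      ultimately show "\<rho> x * (grad (cutoff R) x \<bullet> grad (cutoff R) x) \<le> (4 * exp 1 / R)\<^sup>2 * \<rho> x"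
        by (simp add: power2_norm_eq_inner[symmetric] mult.commute mult_left_mono)
    qed
  qed (use integrable_energy[OF C C] integrable_weight in auto)
  then show ?thesis by simp
qed

lemma lattice_inequality:
  assumes M: "0 < M" "ereal M < mu k \<rho>" and K: "0 \<le> K" and p: "sqrt M \<le> real p" and j: "1 \<le> j"
    and m: "0 < (\<integral>x. \<rho> x * (cutoff (pi * real j) x * cutoff (pi * real j) x) \<partial>lebesgue)" (is "0 < ?m")
  shows "?m * (2 * unit_ball_vol DIM('a) * sqrt M ^ (DIM('a) + 2) / (DIM('a) + 2))
    \<le> M * (real k * ((2 * pi) ^ DIM('a) * K)) + (2 * real p + 1) ^ DIM('a) * ((4 * exp 1 / (pi * real j))\<^sup>2 * (\<integral>x. \<rho> x \<partial>lebesgue))"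
proof -
  let ?N = "DIM('a)"
  \<comment> \<open>\<open>h * L = pi\<close> is the orthogonality condition, and
    \<open>h * n = p \<ge> sqrt M\<close> lets the cells of the lattice piece cover the ball of
    radius \<open>sqrt M\<close>. Multiplication by \<open>h ^ ?N\<close> will turn
    \<open>2 * L\<close> into \<open>2 * pi\<close> and \<open>2 * n + 1\<close> into at most
    \<open>2 * p + 1\<close>, both free of \<open>j\<close>.\<close>
  define L where "L = pi * real j"
  define h where "h = 1 / real j"
  define n where "n = j * p"
  define e where "e = (4 * exp 1 / L)\<^sup>2 * (\<integral>x. \<rho> x \<partial>lebesgue)"
  let ?Z = "lattice_points h n :: 'a set"
  have L: "0 < L" and h: "0 < h" using j by (simp_all add: L_def h_def)
  have r0: "0 \<le> (\<integral>x. \<rho> x \<partial>lebesgue)" using weight_nonneg by (rule integral_nonneg_AE)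
  have e0: "0 \<le> e" using r0 by (simp add: e_def)
  define B where "B = M * (real k * ((2 * L) ^ ?N * K)) + (2 * real n + 1) ^ ?N * e"
  have B0: "0 \<le> B" unfolding B_def using M K L e0 by simp
  have sum_le: "(\<Sum>\<xi>\<in>?Z. ennreal (M - (norm (\<xi> + \<theta>))\<^sup>2)) \<le> ennreal (B / ?m)" for \<theta>
  proof -
    \<comment> \<open>\<open>key_inequality\<close> sums signed terms while \<open>ennreal\<close>
      truncates at \<open>0\<close>. On \<open>Z'\<close> the two agree, and the other lattice
      points contribute \<open>0\<close>.\<close>
    define Z' where "Z' = {\<xi> \<in> ?Z. (norm (\<xi> + \<theta>))\<^sup>2 < M}"
    define I where "I = (\<lambda>\<xi>. \<xi> + \<theta>) ` Z'"
    have fZ: "finite Z'" unfolding Z'_def by (rule finite_subset[OF _ finite_lattice_points[of h n]]) auto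
    have inj: "inj_on (\<lambda>\<xi>. \<xi> + \<theta>) Z'" by (simp add: inj_on_def)
    have cI: "real (card I) \<le> (2 * real n + 1) ^ ?N"
    proof -
      have "card I = card Z'" unfolding I_def by (rule card_image[OF inj])
      also have "\<dots> \<le> card ?Z" unfolding Z'_def using finite_lattice_points by (intro card_mono) auto
      also have "\<dots> \<le> (2 * n + 1) ^ ?N" by (rule card_lattice_points)
      finally have "real (card I) \<le> real ((2 * n + 1) ^ ?N)" by (simp only: of_nat_le_iff)
      then show ?thesis by (simp add: add.commute)
    qed
    have "?m * (\<Sum>\<xi>\<in>I. M - (norm \<xi>)\<^sup>2)
      \<le> M * (real k * ((2 * L) ^ ?N * K)) + real (card I) * (\<integral>x. \<rho> x * (grad (cutoff L) x \<bullet> grad (cutoff L) x) \<partial>lebesgue)"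
      unfolding L_def[symmetric]
    proof (rule key_inequality)
      show "cutoff L \<in> Cc_infinity" by (rule cutoff_Cc_infinity[OF L])
      show "\<bar>cutoff L x\<bar> \<le> 1" for x :: 'a using cutoff_bounds[of L x] by simp
      show "cutoff L x = 0" if x: "x \<notin> cbox (- (L *\<^sub>R One)) (L *\<^sub>R One)" for x :: 'a
      proof (rule cutoff_eq_0[OF L])
        obtain b where b: "b \<in> Basis" "\<not> (- L \<le> x \<bullet> b \<and> x \<bullet> b \<le> L)"
          using x by (auto simp: mem_box)
        then have "L < \<bar>x \<bullet> b\<bar>" by auto
        then show "L \<le> norm x" using Basis_le_norm[OF b(1), of x] by simp
      qed
      show "finite I" unfolding I_def using fZ by simp
      show "sin (((\<xi> - \<eta>) \<bullet> b) * L) = 0" if I: "\<xi> \<in> I" "\<eta> \<in> I" and b: "b \<in> Basis" for \<xi> \<eta> b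
      proof -
        obtain \<xi>' \<eta>' where z: "\<xi>' \<in> ?Z" "\<eta>' \<in> ?Z" "\<xi> = \<xi>' + \<theta>" "\<eta> = \<eta>' + \<theta>"
          using I unfolding I_def Z'_def by auto
        obtain a c :: int where "\<xi>' \<bullet> b = h * of_int a" "\<eta>' \<bullet> b = h * of_int c"
          using lattice_points_inner z(1,2) b by metis
        then have "((\<xi> - \<eta>) \<bullet> b) * L = of_int (a - c) * pi"
          using j unfolding z(3,4) by (simp add: inner_diff_left inner_add_left h_def L_def field_simps)
        then show ?thesis unfolding sin_zero_iff_int2 by blast
      qed
    qed (use L M K in auto)
    also have "\<dots> \<le> B"
      unfolding B_def e_def using cI cutoff_energy_le[OF L] weight_nonneg
      by (intro add_left_mono mult_mono) (auto intro!: integral_nonneg_AE elim: eventually_mono)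
    finally have le: "(\<Sum>\<xi>\<in>I. M - (norm \<xi>)\<^sup>2) \<le> B / ?m"
      using m by (simp add: pos_le_divide_eq mult.commute)
    have "(\<Sum>\<xi>\<in>?Z. ennreal (M - (norm (\<xi> + \<theta>))\<^sup>2)) = (\<Sum>\<xi>\<in>Z'. ennreal (M - (norm (\<xi> + \<theta>))\<^sup>2))"
      by (rule sum.mono_neutral_right) (auto simp: Z'_def finite_lattice_points ennreal_eq_0_iff)
    also have "\<dots> = ennreal (\<Sum>\<xi>\<in>Z'. M - (norm (\<xi> + \<theta>))\<^sup>2)"
      by (rule sum_ennreal) (simp add: Z'_def)
    also have "(\<Sum>\<xi>\<in>Z'. M - (norm (\<xi> + \<theta>))\<^sup>2) = (\<Sum>\<xi>\<in>I. M - (norm \<xi>)\<^sup>2)"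
      unfolding I_def by (simp add: sum.reindex[OF inj])
    finally show ?thesis using le by (simp add: ennreal_leI)
  qed
  have hn: "h * real n = real p" using j by (simp add: h_def n_def)
  have "(\<integral>\<^sup>+x. ennreal (M - (norm (x::'a))\<^sup>2) \<partial>lborel) \<le> ennreal (B / ?m) * ennreal (h ^ ?N)"
  proof (rule nn_integral_le_lattice_sums[OF h _ _ sum_le])
    show "ennreal (M - (norm x)\<^sup>2) = 0" if "h * real n < norm x" for x :: 'a
    proof -
      have "sqrt M < norm x" using that p by (simp add: hn)
      then have "M < (norm x)\<^sup>2" using power_strict_mono[of "sqrt M" "norm x" 2] M(1) by simp
      then show ?thesis by (simp add: ennreal_neg)
    qed
  qed measurable
  moreover have "(\<integral>\<^sup>+x. ennreal (M - (norm (x::'a))\<^sup>2) \<partial>lborel)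
      = ennreal (2 * unit_ball_vol ?N * sqrt M ^ (?N + 2) / (?N + 2))"
    using nn_integral_ball_deficit[of "sqrt M", where 'a = 'a] M(1) by simp
  moreover have mult: "ennreal (B / ?m) * ennreal (h ^ ?N) = ennreal (B / ?m * h ^ ?N)"
    using B0 m h by (intro ennreal_mult[symmetric]) auto
  ultimately have "ennreal (2 * unit_ball_vol ?N * sqrt M ^ (?N + 2) / (?N + 2)) \<le> ennreal (B / ?m * h ^ ?N)"
    by (simp only: mult)
  then have "2 * unit_ball_vol ?N * sqrt M ^ (?N + 2) / (?N + 2) \<le> B / ?m * h ^ ?N"
    using B0 m h by (subst (asm) ennreal_le_iff) auto
  then have "?m * (2 * unit_ball_vol ?N * sqrt M ^ (?N + 2) / (?N + 2)) \<le> ?m * (B / ?m * h ^ ?N)"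
    using m by (intro mult_left_mono) auto
  also have "\<dots> = B * h ^ ?N" using m by simp
  also have "\<dots> = M * (real k * ((2 * L * h) ^ ?N * K)) + ((2 * real n + 1) * h) ^ ?N * e"
  proof -
    have "(a * (b * (c * K)) + d * e) * t = a * (b * (c * t * K)) + d * t * e" for a b c d t :: real
      by (simp add: algebra_simps)
    then show ?thesis
      unfolding B_def power_mult_distrib[of "2 * L" h] power_mult_distrib[of "2 * real n + 1" h] .
  qed
  also have "\<dots> \<le> M * (real k * ((2 * pi) ^ ?N * K)) + (2 * real p + 1) ^ ?N * e"
  proof -
    have a: "2 * L * h = 2 * pi" using j by (simp add: L_def h_def)
    have "(2 * real n + 1) * h = 2 * (h * real n) + h" by (simp add: algebra_simps)
    then have "(2 * real n + 1) * h \<le> 2 * real p + 1"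
      unfolding hn using j by (simp add: h_def)
    then show ?thesis
      unfolding a using h e0 by (intro add_mono order_refl mult_right_mono power_mono) auto
  qed
  finally show ?thesis unfolding e_def L_def .
qed

text \<open>\<open>p\<close> is fixed before \<open>j\<close> grows, so the cost of the cutoff
  decays like \<open>1 / j\<^sup>2\<close> while the mass of the cutoff tends to that of the
  constant \<open>1\<close>.\<close>

lemma limit_inequality:
  assumes M: "0 < M" "ereal M < mu k \<rho>" and K: "0 \<le> K" and pos: "0 < (\<integral>x. \<rho> x \<partial>lebesgue)"
  shows "(\<integral>x. \<rho> x \<partial>lebesgue) * (2 * unit_ball_vol DIM('a) * sqrt M ^ (DIM('a) + 2) / (DIM('a) + 2))
    \<le> M * (real k * ((2 * pi) ^ DIM('a) * K))"
proof -
  let ?m = "\<lambda>j. \<integral>x. \<rho> x * (cutoff (pi * real j) x * cutoff (pi * real j) x) \<partial>lebesgue"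
  let ?c = "2 * unit_ball_vol DIM('a) * sqrt M ^ (DIM('a) + 2) / (DIM('a) + 2)"
  obtain p where p: "sqrt M \<le> real p" using real_arch_simple by blast
  let ?b = "\<lambda>j. M * (real k * ((2 * pi) ^ DIM('a) * K)) + (2 * real p + 1) ^ DIM('a) * ((4 * exp 1 / (pi * real j))\<^sup>2 * (\<integral>x. \<rho> x \<partial>lebesgue))"
  have R: "filterlim (\<lambda>j. pi * real j) at_top sequentially"
    by (rule filterlim_tendsto_pos_mult_at_top[OF tendsto_const pi_gt_zero filterlim_real_sequentially])
  have mlim: "?m \<longlonglongrightarrow> (\<integral>x. \<rho> x \<partial>lebesgue)" by (rule cutoff_mass_tendsto[OF R])
  have "(\<lambda>j. ?m j * ?c) \<longlonglongrightarrow> (\<integral>x. \<rho> x \<partial>lebesgue) * ?c"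
    by (rule tendsto_mult[OF mlim tendsto_const])
  moreover have "?b \<longlonglongrightarrow> M * (real k * ((2 * pi) ^ DIM('a) * K)) + (2 * real p + 1) ^ DIM('a) * (0\<^sup>2 * (\<integral>x. \<rho> x \<partial>lebesgue))"
    by (intro tendsto_add tendsto_mult tendsto_power tendsto_const tendsto_divide_0[OF tendsto_const]
        filterlim_at_top_imp_at_infinity R)
  moreover have "eventually (\<lambda>j. ?m j * ?c \<le> ?b j) sequentially"
    using order_tendstoD(1)[OF mlim pos] eventually_ge_at_top[of 1]
    by eventually_elim (rule lattice_inequality[OF M K p])
  ultimately have "(\<integral>x. \<rho> x \<partial>lebesgue) * ?c
      \<le> M * (real k * ((2 * pi) ^ DIM('a) * K)) + (2 * real p + 1) ^ DIM('a) * (0\<^sup>2 * (\<integral>x. \<rho> x \<partial>lebesgue))"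
    by (intro tendsto_le[OF trivial_limit_sequentially])
  then show ?thesis by simp
qed

lemma kroeger_bound:
  assumes K: "0 \<le> K" and pos: "0 < (\<integral>x. \<rho> x \<partial>lebesgue)"
  shows "mu k \<rho> \<le> ereal (4 * pi\<^sup>2 *
    ((real DIM('a) + 2) * real k / (2 * unit_ball_vol DIM('a)) * (K / (\<integral>x. \<rho> x \<partial>lebesgue))) powr (2 / real DIM('a)))"
proof (rule ccontr)
  let ?N = "DIM('a)"
  define X where "X = (real ?N + 2) * real k / (2 * unit_ball_vol ?N) * (K / (\<integral>x. \<rho> x \<partial>lebesgue))"
  assume "\<not> ?thesis"
  then have "ereal (4 * pi\<^sup>2 * X powr (2 / real ?N)) < mu k \<rho>" by (simp add: X_def)
  \<comment> \<open>A real \<open>M\<close> lies strictly in between even if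
    \<open>mu k \<rho>\<close> is infinite. As it exceeds a nonnegative bound it is positive, also
    for \<open>k = 0\<close>, where \<open>X\<close> and the bound are \<open>0\<close>.\<close>
  from ereal_dense2[OF this] obtain M where
    M: "4 * pi\<^sup>2 * X powr (2 / real ?N) < M" "ereal M < mu k \<rho>" by auto
  have X0: "0 \<le> X" using K pos by (simp add: X_def unit_ball_vol_nonneg)
  have "0 \<le> 4 * pi\<^sup>2 * X powr (2 / real ?N)" by simp
  with M have M0: "0 < M" by linarith
  have w: "0 < unit_ball_vol ?N" by (simp add: unit_ball_vol_pos)
  \<comment> \<open>One factor \<open>M\<close> cancels against the right side of
    \<open>limit_inequality\<close>. The power \<open>?N\<close> of \<open>sqrt M\<close> that
    remains is removed by raising to \<open>2 / ?N\<close>, which turns \<open>(2 * pi) ^ ?N\<close>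
    into \<open>4 * pi\<^sup>2\<close>.\<close>
  have p: "sqrt M ^ (?N + 2) = M * sqrt M ^ ?N" using M0 by (simp add: power_add)
  have "M * ((\<integral>x. \<rho> x \<partial>lebesgue) * (2 * unit_ball_vol ?N * sqrt M ^ ?N / (?N + 2))) \<le> M * (real k * ((2 * pi) ^ ?N * K))"
    using limit_inequality[OF M0 M(2) K pos] unfolding p by (simp add: mult_ac)
  then have "(\<integral>x. \<rho> x \<partial>lebesgue) * (2 * unit_ball_vol ?N * sqrt M ^ ?N / (?N + 2)) \<le> real k * ((2 * pi) ^ ?N * K)"
    by (rule mult_left_le_imp_le[OF _ M0])
  then have "sqrt M ^ ?N \<le> (2 * pi) ^ ?N * X"
    using pos w by (simp add: X_def field_simps)
  then have "(sqrt M ^ ?N) powr (2 / real ?N) \<le> ((2 * pi) ^ ?N * X) powr (2 / real ?N)"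
    using M0 by (intro powr_mono2) auto
  moreover have pw: "(y ^ ?N) powr (2 / real ?N) = y\<^sup>2" if "0 < y" for y :: real
    using that by (simp add: powr_powr flip: powr_realpow powr_numeral)
  moreover have "(sqrt M)\<^sup>2 = M" using M0 by simp
  ultimately have "M \<le> (2 * pi)\<^sup>2 * X powr (2 / real ?N)"
    using X0 M0 pw[of "2 * pi"] pw[of "sqrt M"] by (simp add: powr_mult)
  then show False using M(1) by (simp add: power_mult_distrib)
qed

end

theorem theorem3:
  fixes \<rho> :: "real ^ 'n \<Rightarrow> real" and k :: nat
  assumes "CARD('n) \<ge> 2"
    and "integrable lebesgue \<rho>"
    and "Linf_norm \<rho> < \<infinity>"
    and "AE x in lebesgue. 0 \<le> \<rho> x"
    and "\<not> (AE x in lebesgue. \<rho> x = 0)"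
  shows "mu k \<rho> \<le> ereal (4 * pi\<^sup>2 *
    ((real CARD('n) + 2) * real k / (2 * measure lebesgue (ball (0 :: real ^ 'n) 1)) *
      (real_of_ereal (Linf_norm \<rho>) / (\<integral>x. \<bar>\<rho> x\<bar> \<partial>lebesgue))) powr (2 / real CARD('n)))"
proof -
  have le: "AE x in lebesgue. ereal \<bar>\<rho> x\<bar> \<le> Linf_norm \<rho>"
    unfolding Linf_norm_def by (rule esssup_AE)
  \<comment> \<open>A negative essential supremum would lie above absolute values almost everywhere.
    This is absurd pointwise, so it would even give \<open>\<rho> = 0\<close> almost everywhere,
    which is excluded.\<close>
  have "0 \<le> Linf_norm \<rho>"
  proof (rule ccontr)
    assume neg: "\<not> 0 \<le> Linf_norm \<rho>"
    have "AE x in lebesgue. \<rho> x = 0"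
      using le
    proof eventually_elim
      fix x assume "ereal \<bar>\<rho> x\<bar> \<le> Linf_norm \<rho>"
      then have "0 \<le> Linf_norm \<rho>" by (meson abs_ge_zero ereal_less_eq(5) order_trans)
      then show "\<rho> x = 0" using neg by simp
    qed
    then show False using assms(5) by simp
  qed
  then obtain K where K: "Linf_norm \<rho> = ereal K" "0 \<le> K"
    using assms(3) by (cases "Linf_norm \<rho>") auto
  have leK: "AE x in lebesgue. \<rho> x \<le> K"
    using le by eventually_elim (simp add: K(1))
  interpret weight \<rho> K
    by unfold_locales (use assms(2,4) leK in auto)
  have abs: "(\<integral>x. \<bar>\<rho> x\<bar> \<partial>lebesgue) = (\<integral>x. \<rho> x \<partial>lebesgue)"
    using assms(4) by (intro integral_cong_AE) (auto elim: eventually_mono)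
  have "(\<integral>x. \<rho> x \<partial>lebesgue) \<noteq> 0"
    using integral_nonneg_eq_0_iff_AE[OF assms(2,4)] assms(5) by simp
  then have "0 < (\<integral>x. \<rho> x \<partial>lebesgue)"
    using integral_nonneg_AE[OF assms(4)] by simp
  from kroeger_bound[OF K(2) this] show ?thesis
    by (simp add: K(1) abs content_ball)
qed

end
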